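(* Let $m\ge 0$ be a fixed integer. For each $n\ge 1$ let $\{X_{n,i}:1\le i\le n+m\}$ be a temporally non-homogeneous Markov chain with values in a Borel space $\mathcal{X}$, let $f_{n,i}:\mathcal{X}^{1+m}\to\mathbb{R}$, $1\le i\le n$, be measurable functions, and set $$S_n=\sum_{i=1}^n Z_{n,i},\qquad Z_{n,i}=f_{n,i}(X_{n,i},\ldots,X_{n,i+m}).$$ Let $\alpha_n$ be the minimal ergodic coefficient of the $n$-th row and let $C_1,C_2,\ldots$ be constants with $\max_{1\le i\le n}\|f_{n,i}\|_\infty\le C_n$ for all $n$. If there are constants $c>0$ and $C<\infty$ such that $$\alpha_n\ge c\quad\text{and}\quad C_n\le C\qquad\text{for all } n\ge 1,$$ then $$\frac{S_n-\mathbb{E}[S_n]}{\sqrt{\operatorname{Var}[S_n]}}\Longrightarrow N(0,1)\qquad\text{as } n\to\infty$$ whenever $\operatorname{Var}[S_n]\to\infty$ as $n\to\infty$.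
   Context: Temporally non-homogeneous Markov chain: for each $n$, the row $\{X_{n,i}:1\le i\le n+m\}$ is a Markov process determined by an arbitrary initial distribution of $X_{n,1}$ and by Markov transition kernels $K^{(n)}_{i,i+1}$ on $\mathcal{X}$, where $K^{(n)}_{i,i+1}(x,B)=\mathbb{P}(X_{n,i+1}\in B\mid X_{n,i}=x)$ for $x\in\mathcal{X}$ and $B\in\mathcal{B}(\mathcal{X})$ (the Borel sets of $\mathcal{X}$); the kernels may depend on $i$ and $n$. For a Markov transition kernel $K$ on $\mathcal{X}$, the Dobrushin contraction coefficient is $\delta(K)=\sup_{x_1,x_2\in\mathcal{X},\,B\in\mathcal{B}(\mathcal{X})}|K(x_1,B)-K(x_2,B)|$ and the ergodic coefficient is $\alpha(K)=1-\delta(K)$. The minimal ergodic coefficient of the $n$-th row is $\alpha_n=\min_{1\le i<n}\alpha(K^{(n)}_{i,i+1})$ (only the kernels with $1\le i<n$ enter; $\alpha_1=1$ by convention). $\|f\|_\infty$ is the supremum norm. *)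

theory Defs
  imports "HOL-Probability.Probability"
begin

text \<open>A Borel space is a Borel subset \<open>S\<close> of a Polish space, with the trace sigma-algebra.\<close>

abbreviation borel_on :: "'a::polish_space set \<Rightarrow> 'a measure" where
  "borel_on S \<equiv> restrict_space borel S"

definition dobrushin_coeff :: "'a measure \<Rightarrow> ('a \<Rightarrow> 'a measure) \<Rightarrow> real" where
  "dobrushin_coeff E K =
     (SUP (x\<^sub>1, x\<^sub>2, B) \<in> space E \<times> space E \<times> sets E.
        \<bar>measure (K x\<^sub>1) B - measure (K x\<^sub>2) B\<bar>)"

definition ergodic_coeff :: "'a measure \<Rightarrow> ('a \<Rightarrow> 'a measure) \<Rightarrow> real" where
  "ergodic_coeff E K = 1 - dobrushin_coeff E K"

text \<open>\<open>K i\<close> is the kernel for the step from time \<open>i\<close> to time \<open>i + 1\<close>. Although a row of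
  length \<open>n + m\<close> has more kernels, only those with \<open>1 \<le> i < n\<close> enter.\<close>

definition min_ergodic_coeff :: "'a measure \<Rightarrow> nat \<Rightarrow> (nat \<Rightarrow> 'a \<Rightarrow> 'a measure) \<Rightarrow> real" where
  "min_ergodic_coeff E n K = (if n \<le> 1 then 1 else (MIN i\<in>{1..<n}. ergodic_coeff E (K i)))"

definition past_algebra ::
  "'w measure \<Rightarrow> 'a measure \<Rightarrow> (nat \<Rightarrow> 'w \<Rightarrow> 'a) \<Rightarrow> nat \<Rightarrow> 'w measure" where
  "past_algebra M E X i =
     vimage_algebra (space M) (\<lambda>\<omega>. \<lambda>j\<in>{1..i}. X j \<omega>) (\<Pi>\<^sub>M j\<in>{1..i}. E)"

text \<open>\<open>X 1, \<dots>, X N\<close> is a Markov chain in \<open>E\<close> on the probability space \<open>M\<close> with transition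
  kernels \<open>K 1, \<dots>, K (N - 1)\<close> and unconstrained initial law: conditionally on the whole
  past, \<open>X (i + 1)\<close> has law \<open>K i (X i)\<close>.\<close>

definition markov_chain ::
  "'w measure \<Rightarrow> 'a measure \<Rightarrow> nat \<Rightarrow> (nat \<Rightarrow> 'a \<Rightarrow> 'a measure) \<Rightarrow> (nat \<Rightarrow> 'w \<Rightarrow> 'a) \<Rightarrow> bool"
where
  "markov_chain M E N K X \<longleftrightarrow>
     prob_space M \<and>
     (\<forall>i\<in>{1..N}. X i \<in> M \<rightarrow>\<^sub>M E) \<and>
     (\<forall>i\<in>{1..<N}. K i \<in> E \<rightarrow>\<^sub>M prob_algebra E) \<and>
     (\<forall>i\<in>{1..<N}. \<forall>B\<in>sets E. AE \<omega> in M.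
        real_cond_exp M (past_algebra M E X i) (\<lambda>\<omega>. indicator B (X (i + 1) \<omega>)) \<omega>
          = measure (K i (X i \<omega>)) B)"

text \<open>The product of \<open>1 + m\<close> copies of \<open>E\<close>, with coordinates indexed by \<open>0, \<dots>, m\<close>.\<close>

abbreviation block_space :: "nat \<Rightarrow> 'a measure \<Rightarrow> (nat \<Rightarrow> 'a) measure" where
  "block_space m E \<equiv> (\<Pi>\<^sub>M j\<in>{0..m}. E)"

definition block :: "nat \<Rightarrow> (nat \<Rightarrow> 'w \<Rightarrow> 'a) \<Rightarrow> nat \<Rightarrow> 'w \<Rightarrow> (nat \<Rightarrow> 'a)" where
  "block m X i \<omega> = (\<lambda>j\<in>{0..m}. X (i + j) \<omega>)"

definition row_sum ::
  "nat \<Rightarrow> nat \<Rightarrow> (nat \<Rightarrow> (nat \<Rightarrow> 'a) \<Rightarrow> real) \<Rightarrow> (nat \<Rightarrow> 'w \<Rightarrow> 'a) \<Rightarrow> 'w \<Rightarrow> real" where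
  "row_sum m n f X \<omega> = (\<Sum>i=1..n. f i (block m X i \<omega>))"

text \<open>The supremum norm is extended-real valued, so that it is \<open>\<infinity>\<close> for unbounded functions.\<close>

definition sup_norm :: "'b measure \<Rightarrow> ('b \<Rightarrow> real) \<Rightarrow> ereal" where
  "sup_norm E f = (SUP x\<in>space E. ereal \<bar>f x\<bar>)"

end

theory Submission
  imports Defs
begin

text \<open>
  Work on the law of the path \<open>X\<^sub>1, \<dots>, X\<^sub>N\<close>, \<open>N = n + m\<close>, where conditioning on the first \<open>k\<close>
  coordinates is given by explicit kernel integrals \<open>Q k\<close>, and write \<open>S - E[S]\<close> as the sum of
  the martingale differences \<open>D k = Q (k + 1) S - Q k S\<close>. Dobrushin contraction bounds these
  differences uniformly and makes \<open>E[D\<^sub>k\<^sup>2 | F\<^sub>j] - E[D\<^sub>k\<^sup>2]\<close> decay geometrically in \<open>k - j\<close>.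

  For such a martingale with total variance \<open>s\<^sup>2\<close>, telescope \<open>E[exp(itS\<^sub>k/s)] exp(t\<^sup>2 v\<^sub>k / 2)\<close> with the
  deterministic \<open>v\<^sub>k = \<Sum>\<^sub>i\<^sub><\<^sub>k E[D\<^sub>i\<^sup>2] / s\<^sup>2\<close>. The only error that is not of third order is
  \<open>E[exp(itS\<^sub>k/s) (D\<^sub>k\<^sup>2 - E[D\<^sub>k\<^sup>2])]\<close>. Telescoping \<open>exp(itS\<^sub>k/s)\<close> over \<open>j < k\<close> and conditioning the
  \<open>j\<close>-th increment on \<open>F\<^sub>j\<^sub>+\<^sub>1\<close> leaves products \<open>\<bar>D\<^sub>j\<bar> \<bar>h\<^sub>j\<^sub>k\<bar>\<close>, where \<open>h\<^sub>j\<^sub>k\<close> is the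
  conditional fluctuation of \<open>D\<^sub>k\<^sup>2\<close>; by the arithmetic-geometric mean inequality
  these are at most \<open>q\<^sup>k\<^sup>-\<^sup>j (E[D\<^sub>j\<^sup>2] + E[D\<^sub>k\<^sup>2])\<close> up to a constant, so they sum to \<open>O(s\<^sup>2)\<close> and the
  characteristic functions differ by \<open>O(1/s)\<close>.
\<close>

section \<open>Characteristic functions of bounded mixing martingales\<close>

lemma norm_iexp_minus_1_le: "cmod (iexp x - 1) \<le> \<bar>x\<bar>"
  using iexp_approx1[of x 0] by simp

lemma norm_iexp_quadratic_le: "cmod (iexp x - (1 + \<i> * x - complex_of_real (x\<^sup>2 / 2))) \<le> \<bar>x\<bar> ^ 3 / 6"
proof -
  have "(\<Sum>k\<le>2. (\<i> * x) ^ k / fact k) = 1 + \<i> * x - complex_of_real (x\<^sup>2 / 2)"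
    by (simp add: numeral_2_eq_2 power2_eq_square field_simps)
  then show ?thesis
    using iexp_approx1[of x 2] by (simp add: numeral_3_eq_3 fact_numeral)
qed

lemma exp_neg_quadratic_le:
  fixes x :: real
  assumes "x \<ge> 0"
  shows "\<bar>exp (- x) - (1 - x)\<bar> \<le> x\<^sup>2 / 2"
proof -
  have "1 - x \<le> exp (- x)"
    using exp_ge_add_one_self[of "-x"] by simp
  moreover have "exp (- x) \<le> 1 - x + x\<^sup>2 / 2"
  proof -
    define f where "f = (\<lambda>y::real. 1 - y + y\<^sup>2 / 2 - exp (- y))"
    have "f 0 \<le> f x"
    proof (rule DERIV_nonneg_imp_nondecreasing[OF assms])
      fix y :: real assume "0 \<le> y"
      have "(f has_real_derivative (- 1 + y + exp (- y))) (at y)"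
        unfolding f_def by (auto intro!: derivative_eq_intros)
      moreover have "- 1 + y + exp (- y) \<ge> 0"
        using exp_ge_add_one_self[of "-y"] by simp
      ultimately show "\<exists>z. (f has_real_derivative z) (at y) \<and> 0 \<le> z" by blast
    qed
    then show ?thesis by (simp add: f_def)
  qed
  ultimately show ?thesis by simp
qed

lemma norm_integral_le:
  fixes f :: "'a \<Rightarrow> 'b::{banach, second_countable_topology}"
  assumes "integrable M f" "integrable M g" "\<And>x. x \<in> space M \<Longrightarrow> norm (f x) \<le> g x"
  shows "norm (\<integral>x. f x \<partial>M) \<le> (\<integral>x. g x \<partial>M)"
  by (rule order_trans[OF integral_norm_bound integral_mono]) (use assms in auto)

lemma (in prob_space) integrable_bounded:
  fixes f :: "'a \<Rightarrow> 'b::{banach, second_countable_topology}"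
  assumes "f \<in> borel_measurable M" "\<And>x. x \<in> space M \<Longrightarrow> norm (f x) \<le> B"
  shows "integrable M f"
  using assms by (intro integrable_const_bound[where B = B]) auto

text \<open>Splitting into cosine and sine lets every martingale or projection property be assumed
  for real bounded test functions only and still be used for complex exponentials.\<close>

lemma (in prob_space) expectation_iexp_mult:
  assumes [measurable]: "Y \<in> borel_measurable M" "w \<in> borel_measurable M"
    and w: "\<And>x. x \<in> space M \<Longrightarrow> \<bar>w x\<bar> \<le> B"
  shows "expectation (\<lambda>x. iexp (Y x) * complex_of_real (w x)) =
    complex_of_real (expectation (\<lambda>x. cos (Y x) * w x)) +
    \<i> * complex_of_real (expectation (\<lambda>x. sin (Y x) * w x))"
proof -
  have [simp]: "integrable M (\<lambda>x. cos (Y x) * w x)" "integrable M (\<lambda>x. sin (Y x) * w x)"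
    using w mult_mono[of "\<bar>cos (Y x)\<bar>" 1 "\<bar>w x\<bar>" B for x] mult_mono[of "\<bar>sin (Y x)\<bar>" 1 "\<bar>w x\<bar>" B for x]
    by (auto intro!: integrable_bounded[where B = B] simp: abs_mult)
  have "iexp (Y x) * complex_of_real (w x) =
      complex_of_real (cos (Y x) * w x) + \<i> * complex_of_real (sin (Y x) * w x)" for x
    by (simp add: exp_Euler cos_of_real sin_of_real algebra_simps)
  then show ?thesis
    by (simp del: of_real_mult)
qed

text \<open>This is 2 a |d| |h| <= a^2 d^2 + h^2, with one factor of h^2 spent on the bound R a^2.
  Both d^2 and |h| then carry the small weight a, and |h| remains to the first power, so that its
  expectation can be compared with a variance.\<close>

lemma abs_mult_le_weighted_square:
  fixes d h a R :: real
  assumes a: "a > 0" and h: "\<bar>h\<bar> \<le> R * a\<^sup>2"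
  shows "\<bar>d\<bar> * \<bar>h\<bar> \<le> a / 2 * (d\<^sup>2 + R * \<bar>h\<bar>)"
proof -
  have "0 \<le> (a * \<bar>d\<bar> - \<bar>h\<bar>)\<^sup>2" by simp
  then have "2 * a * (\<bar>d\<bar> * \<bar>h\<bar>) \<le> a\<^sup>2 * d\<^sup>2 + \<bar>h\<bar> * \<bar>h\<bar>"
    by (simp add: power2_eq_square algebra_simps)
  also have "\<bar>h\<bar> * \<bar>h\<bar> \<le> (R * a\<^sup>2) * \<bar>h\<bar>"
    by (rule mult_right_mono[OF h]) simp
  finally have "a * (\<bar>d\<bar> * \<bar>h\<bar>) \<le> a * (a / 2 * (d\<^sup>2 + R * \<bar>h\<bar>))"
    by (simp add: power2_eq_square algebra_simps)
  then show ?thesis using a by simp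
qed

text \<open>Every row and every column of the triangular array q^(k-1-j), j < k, sums to at most
  1/(1-q). The first bound exchanges the order of summation and uses the columns, the second uses
  the rows directly.\<close>

lemma geometric_double_sum_le:
  fixes q :: real and \<sigma> :: "nat \<Rightarrow> real"
  assumes q: "0 \<le> q" "q < 1" and \<sigma>: "\<And>k. 0 \<le> \<sigma> k"
  shows "(\<Sum>k<N. \<Sum>j<k. q ^ (k - Suc j) * \<sigma> j) \<le> (\<Sum>k<N. \<sigma> k) / (1 - q)"
    and "(\<Sum>k<N. \<Sum>j<k. q ^ (k - Suc j) * \<sigma> k) \<le> (\<Sum>k<N. \<sigma> k) / (1 - q)"
proof -
  have g: "(\<Sum>i\<in>I. q ^ i) \<le> 1 / (1 - q)" if "finite I" for I
    using sum_le_suminf[of "\<lambda>i. q ^ i" I] that q suminf_geometric[of q] summable_geometric[of q]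
    by simp
  have r: "(\<Sum>j<k. q ^ (k - Suc j)) \<le> 1 / (1 - q)" for k
    using g[of "{..<k}"] sum.nat_diff_reindex[of "\<lambda>i. q ^ i" k] by simp
  have c: "(\<Sum>k\<in>{Suc j..<N}. q ^ (k - Suc j)) \<le> 1 / (1 - q)" for j
  proof -
    have "(\<Sum>k\<in>{Suc j..<N}. q ^ (k - Suc j)) = (\<Sum>i\<in>(\<lambda>k. k - Suc j) ` {Suc j..<N}. q ^ i)"
      by (subst sum.reindex) (auto intro!: inj_onI)
    then show ?thesis using g by simp
  qed
  have "(\<Sum>k<N. \<Sum>j<k. q ^ (k - Suc j) * \<sigma> j) = (\<Sum>j<N. \<Sum>k\<in>{Suc j..<N}. q ^ (k - Suc j) * \<sigma> j)"
    unfolding sum.Sigma[OF finite_lessThan ballI[OF finite_lessThan]]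
      sum.Sigma[OF finite_lessThan ballI[OF finite_atLeastLessThan]]
    by (rule sum.reindex_bij_witness[of _ "\<lambda>(j, k). (k, j)" "\<lambda>(j, k). (k, j)"]) auto
  also have "\<dots> \<le> (\<Sum>j<N. 1 / (1 - q) * \<sigma> j)"
    unfolding sum_distrib_right[symmetric]
    by (intro sum_mono mult_right_mono c \<sigma>)
  finally show "(\<Sum>k<N. \<Sum>j<k. q ^ (k - Suc j) * \<sigma> j) \<le> (\<Sum>k<N. \<sigma> k) / (1 - q)"
    by (simp add: sum_divide_distrib)
  have "(\<Sum>k<N. \<Sum>j<k. q ^ (k - Suc j) * \<sigma> k) \<le> (\<Sum>k<N. 1 / (1 - q) * \<sigma> k)"
    unfolding sum_distrib_right[symmetric]
    by (intro sum_mono mult_right_mono r \<sigma>)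
  then show "(\<Sum>k<N. \<Sum>j<k. q ^ (k - Suc j) * \<sigma> k) \<le> (\<Sum>k<N. \<sigma> k) / (1 - q)"
    by (simp add: sum_divide_distrib)
qed

text \<open>No filtration appears: conditioning is encoded by testing against bounded functions of
  the partial sums. \<open>h j k\<close> plays the role of E[d_k^2 | F_j] - E[d_k^2]. Its decay is
  written as the square of q^(k-j) so that \<open>abs_mult_le_weighted_square\<close> applies with
  weight a = q^(k-j); q is thus the square root of the mixing rate.\<close>

locale mixing_martingale = prob_space M for M :: "'a measure" +
  fixes N :: nat and d :: "nat \<Rightarrow> 'a \<Rightarrow> real" and h :: "nat \<Rightarrow> nat \<Rightarrow> 'a \<Rightarrow> real"
    and B R q :: real
  assumes d_meas [measurable]: "\<And>k. d k \<in> borel_measurable M"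
    and d_bound: "\<And>k x. k < N \<Longrightarrow> x \<in> space M \<Longrightarrow> \<bar>d k x\<bar> \<le> B"
    and martingale: "\<And>k g. k < N \<Longrightarrow> g \<in> borel_measurable borel \<Longrightarrow> bounded (range g) \<Longrightarrow>
      expectation (\<lambda>x. g (\<Sum>i<k. d i x) * d k x) = 0"
    and h_meas [measurable]: "\<And>j k. h j k \<in> borel_measurable M"
    and h_bound: "\<And>j k x. j \<le> k \<Longrightarrow> k < N \<Longrightarrow> x \<in> space M \<Longrightarrow> \<bar>h j k x\<bar> \<le> R * (q ^ (k - j))\<^sup>2"
    and h_expectation: "\<And>j k. j \<le> k \<Longrightarrow> k < N \<Longrightarrow>
      expectation (\<lambda>x. \<bar>h j k x\<bar>) \<le> 2 * expectation (\<lambda>x. (d k x)\<^sup>2)"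
    and h_project: "\<And>i j k g. i \<le> j \<Longrightarrow> j \<le> k \<Longrightarrow> k < N \<Longrightarrow>
      g \<in> borel_measurable borel \<Longrightarrow> bounded (range g) \<Longrightarrow>
      expectation (\<lambda>x. g (\<Sum>l<i. d l x) * ((d k x)\<^sup>2 - expectation (\<lambda>y. (d k y)\<^sup>2))) =
      expectation (\<lambda>x. g (\<Sum>l<i. d l x) * h j k x)"
    and B_nonneg: "0 \<le> B" and R_nonneg: "0 \<le> R" and q: "0 < q" "q < 1"
begin

section \<open>Comparison of the characteristic function with the Gaussian one\<close>

definition \<sigma> :: "nat \<Rightarrow> real" where "\<sigma> k = expectation (\<lambda>x. (d k x)\<^sup>2)"

definition psum :: "nat \<Rightarrow> 'a \<Rightarrow> real" where "psum k x = (\<Sum>i<k. d i x)"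

lemma psum_meas [measurable]: "psum k \<in> borel_measurable M"
  unfolding psum_def by measurable

lemma psum_Suc: "psum (Suc k) x = psum k x + d k x"
  by (simp add: psum_def)

lemma \<sigma>_nonneg: "0 \<le> \<sigma> k"
  by (simp add: \<sigma>_def)

lemma d_square_bound: "k < N \<Longrightarrow> x \<in> space M \<Longrightarrow> (d k x)\<^sup>2 \<le> B\<^sup>2"
  using d_bound[of k x] by (metis abs_ge_zero power2_abs power_mono)

lemma integrable_d_square: "k < N \<Longrightarrow> integrable M (\<lambda>x. (d k x)\<^sup>2)"
  by (rule integrable_bounded[where B = "B\<^sup>2"]) (auto intro: d_square_bound)

lemma \<sigma>_le: "k < N \<Longrightarrow> \<sigma> k \<le> B\<^sup>2"
  unfolding \<sigma>_def
  by (rule integral_le_const[OF integrable_d_square]) (auto intro: d_square_bound)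

lemma bounded_trig:
  fixes u :: real
  shows "bounded (range (\<lambda>y::real. cos (u * y)))" "bounded (range (\<lambda>y::real. sin (u * y)))"
  by (auto intro!: boundedI[where B = 1])

lemma iexp_martingale:
  assumes "k < N"
  shows "expectation (\<lambda>x. iexp (u * psum k x) * complex_of_real (d k x)) = 0"
proof -
  have "expectation (\<lambda>x. cos (u * psum k x) * d k x) = 0"
       "expectation (\<lambda>x. sin (u * psum k x) * d k x) = 0"
    unfolding psum_def
    using martingale[OF assms _ bounded_trig(1)[of u]] martingale[OF assms _ bounded_trig(2)[of u]]
    by simp_all
  then show ?thesis
    by (subst expectation_iexp_mult[where B = B]) (auto intro: d_bound assms)
qed

lemma iexp_project:
  assumes "i \<le> j" "j \<le> k" "k < N"
  shows "expectation (\<lambda>x. iexp (u * psum i x) * complex_of_real ((d k x)\<^sup>2 - \<sigma> k)) =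
    expectation (\<lambda>x. iexp (u * psum i x) * complex_of_real (h j k x))"
proof -
  have "expectation (\<lambda>x. cos (u * psum i x) * ((d k x)\<^sup>2 - \<sigma> k)) =
      expectation (\<lambda>x. cos (u * psum i x) * h j k x)"
    "expectation (\<lambda>x. sin (u * psum i x) * ((d k x)\<^sup>2 - \<sigma> k)) =
      expectation (\<lambda>x. sin (u * psum i x) * h j k x)"
    unfolding psum_def \<sigma>_def
    using h_project[OF assms _ bounded_trig(1)[of u]] h_project[OF assms _ bounded_trig(2)[of u]]
    by simp_all
  moreover have "\<bar>(d k x)\<^sup>2 - \<sigma> k\<bar> \<le> B\<^sup>2" if "x \<in> space M" for x
    using d_square_bound[OF assms(3) that] \<sigma>_le[OF assms(3)] \<sigma>_nonneg[of k]
      zero_le_power2[of "d k x"] unfolding abs_le_iff by linarith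
  ultimately show ?thesis
    by (subst (1 2) expectation_iexp_mult) (auto intro: h_bound assms)
qed

text \<open>The variable d_k^2 - \<sigma>_k is centred but correlated with exp(iuS_k). Peeling the
  increments d_j off the exponential one at a time, each peeled factor is of size |u d_j| and meets
  only the part of d_k^2 predictable at time j+1, which is geometrically small in k-j.\<close>

lemma variance_fluctuation:
  assumes k: "k < N"
  shows "cmod (expectation (\<lambda>x. iexp (u * psum k x) * complex_of_real ((d k x)\<^sup>2 - \<sigma> k)))
    \<le> \<bar>u\<bar> / 2 * (\<Sum>j<k. q ^ (k - Suc j) * (\<sigma> j + 2 * R * \<sigma> k))"
proof -
  define w where "w x = (d k x)\<^sup>2 - \<sigma> k" for x
  have w_bound: "\<bar>w x\<bar> \<le> B\<^sup>2" if "x \<in> space M" for x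
    using d_square_bound[OF k that] \<sigma>_le[OF k] \<sigma>_nonneg[of k] zero_le_power2[of "d k x"]
    unfolding abs_le_iff w_def by linarith
  have [measurable]: "w \<in> borel_measurable M" unfolding w_def by measurable
  define E where "E i = expectation (\<lambda>x. iexp (u * psum i x) * complex_of_real (w x))" for i
  have int: "integrable M (\<lambda>x. iexp (u * psum i x) * complex_of_real (w x))" for i
    by (rule integrable_bounded[where B = "B\<^sup>2"]) (auto simp: norm_mult intro: w_bound)
  have "E 0 = complex_of_real (expectation w)"
    by (simp add: E_def psum_def)
  also have "expectation w = 0"
    unfolding w_def using integrable_d_square[OF k] by (simp add: \<sigma>_def prob_space)
  finally have E0: "E 0 = 0" by simp
  have step: "cmod (E (Suc j) - E j) \<le> \<bar>u\<bar> / 2 * (q ^ (k - Suc j) * (\<sigma> j + 2 * R * \<sigma> k))"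
    if j: "j < k" for j
  proof -
    have inth: "integrable M (\<lambda>x. iexp (u * psum i x) * complex_of_real (h (Suc j) k x))" for i
      by (rule integrable_bounded) (use j k in \<open>auto simp: norm_mult intro: h_bound\<close>)
    \<comment> \<open>Both S_j and S_(j+1) are known at time j+1, so both exponentials are projected
      to the same level and the difference has the common factor \<open>h (Suc j) k\<close>.\<close>
    have "E (Suc j) - E j =
        expectation (\<lambda>x. iexp (u * psum (Suc j) x) * complex_of_real (h (Suc j) k x)) -
        expectation (\<lambda>x. iexp (u * psum j x) * complex_of_real (h (Suc j) k x))"
      unfolding E_def w_def using j k
      by (simp only: iexp_project[of "Suc j" "Suc j" k u] iexp_project[of j "Suc j" k u] order_refl
          Suc_leI le_SucI)
    also have "\<dots> = expectation (\<lambda>x. (iexp (u * psum (Suc j) x) - iexp (u * psum j x)) *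
        complex_of_real (h (Suc j) k x))"
      by (simp only: left_diff_distrib Bochner_Integration.integral_diff[OF inth inth])
    also have "cmod \<dots> \<le> expectation (\<lambda>x. \<bar>u\<bar> / 2 * (q ^ (k - Suc j) * ((d j x)\<^sup>2 + R * \<bar>h (Suc j) k x\<bar>)))"
    proof (rule norm_integral_le)
      show "integrable M (\<lambda>x. (iexp (u * psum (Suc j) x) - iexp (u * psum j x)) *
          complex_of_real (h (Suc j) k x))"
        unfolding left_diff_distrib by (intro Bochner_Integration.integrable_diff inth)
      have "integrable M (\<lambda>x. \<bar>h (Suc j) k x\<bar>)"
        by (rule integrable_bounded) (use j k in \<open>auto intro: h_bound\<close>)
      then show "integrable M (\<lambda>x. \<bar>u\<bar> / 2 * (q ^ (k - Suc j) * ((d j x)\<^sup>2 + R * \<bar>h (Suc j) k x\<bar>)))"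
        using integrable_d_square[of j] j k by simp
      fix x assume x: "x \<in> space M"
      have "iexp (u * psum (Suc j) x) - iexp (u * psum j x) =
          iexp (u * psum j x) * (iexp (u * d j x) - 1)"
        by (simp add: psum_Suc distrib_left exp_add algebra_simps)
      then have "cmod ((iexp (u * psum (Suc j) x) - iexp (u * psum j x)) * complex_of_real (h (Suc j) k x))
          \<le> \<bar>u * d j x\<bar> * \<bar>h (Suc j) k x\<bar>"
        using norm_iexp_minus_1_le[of "u * d j x"]
        by (simp add: norm_mult mult_right_mono del: of_real_mult)
      also have "\<dots> = \<bar>u\<bar> * (\<bar>d j x\<bar> * \<bar>h (Suc j) k x\<bar>)"
        by (simp add: abs_mult)
      \<comment> \<open>The weight is a = q^(k-j-1), whose square is the decay in the bound on
        \<open>h (Suc j) k\<close>.\<close>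
      also have "\<dots> \<le> \<bar>u\<bar> * (q ^ (k - Suc j) / 2 * ((d j x)\<^sup>2 + R * \<bar>h (Suc j) k x\<bar>))"
        using j k x q by (intro mult_left_mono abs_mult_le_weighted_square h_bound) auto
      finally show "cmod ((iexp (u * psum (Suc j) x) - iexp (u * psum j x)) *
          complex_of_real (h (Suc j) k x))
          \<le> \<bar>u\<bar> / 2 * (q ^ (k - Suc j) * ((d j x)\<^sup>2 + R * \<bar>h (Suc j) k x\<bar>))"
        by simp
    qed
    also have "\<dots> = \<bar>u\<bar> / 2 * (q ^ (k - Suc j) * (\<sigma> j + R * expectation (\<lambda>x. \<bar>h (Suc j) k x\<bar>)))"
    proof -
      have "integrable M (\<lambda>x. \<bar>h (Suc j) k x\<bar>)"
        by (rule integrable_bounded) (use j k in \<open>auto intro: h_bound\<close>)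
      then show ?thesis using integrable_d_square[of j] j k by (simp add: \<sigma>_def)
    qed
    also have "\<dots> \<le> \<bar>u\<bar> / 2 * (q ^ (k - Suc j) * (\<sigma> j + R * (2 * \<sigma> k)))"
      unfolding \<sigma>_def using j k q R_nonneg
      by (intro mult_left_mono add_left_mono h_expectation) auto
    finally show ?thesis by (simp only: mult.left_commute[of R 2] mult.assoc)
  qed
  have "E k = (\<Sum>j<k. E (Suc j) - E j)"
    using E0 by (simp add: sum_lessThan_telescope)
  also have "cmod \<dots> \<le> (\<Sum>j<k. \<bar>u\<bar> / 2 * (q ^ (k - Suc j) * (\<sigma> j + 2 * R * \<sigma> k)))"
    by (rule order_trans[OF norm_sum sum_mono], rule step) simp
  finally show ?thesis
    unfolding E_def w_def by (simp add: sum_distrib_left)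
qed

text \<open>Expand exp(iud_k) to second order. The linear term has mean zero against exp(iuS_k), and
  d_k^2 is split into \<sigma>_k and its fluctuation. Replacing 1 - u^2 \<sigma>_k / 2 by an
  exponential costs a fourth-order term.\<close>

lemma char_step:
  assumes k: "k < N"
  shows "cmod (expectation (\<lambda>x. iexp (u * psum (Suc k) x)) -
      complex_of_real (exp (- (u\<^sup>2 * \<sigma> k / 2))) * expectation (\<lambda>x. iexp (u * psum k x)))
    \<le> \<bar>u\<bar> ^ 3 * B / 6 * \<sigma> k + u ^ 4 * B\<^sup>2 / 8 * \<sigma> k +
      u\<^sup>2 / 2 * cmod (expectation (\<lambda>x. iexp (u * psum k x) * complex_of_real ((d k x)\<^sup>2 - \<sigma> k)))"
proof -
  define e where "e x = iexp (u * psum k x)" for x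
  have [measurable]: "e \<in> borel_measurable M" unfolding e_def by measurable
  have e1 [simp]: "cmod (e x) = 1" for x by (simp add: e_def)
  have ie: "integrable M e" by (rule integrable_bounded[where B = 1]) auto
  define r where "r x = iexp (u * d k x) - (1 + \<i> * complex_of_real (u * d k x) - complex_of_real ((u * d k x)\<^sup>2 / 2))" for x
  have [measurable]: "r \<in> borel_measurable M" unfolding r_def by measurable
  have r_le: "cmod (r x) \<le> \<bar>u\<bar> ^ 3 * B / 6 * (d k x)\<^sup>2" if x: "x \<in> space M" for x
  proof -
    have "cmod (r x) \<le> \<bar>u * d k x\<bar> ^ 3 / 6"
      unfolding r_def by (rule norm_iexp_quadratic_le)
    also have "\<dots> = \<bar>u\<bar> ^ 3 / 6 * (d k x)\<^sup>2 * \<bar>d k x\<bar>"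
      unfolding power2_abs[of "d k x", symmetric]
      by (simp only: abs_mult power_mult_distrib power3_eq_cube power2_eq_square times_divide_eq_left times_divide_eq_right mult_ac)
    also have "\<dots> \<le> \<bar>u\<bar> ^ 3 / 6 * (d k x)\<^sup>2 * B"
      by (intro mult_left_mono d_bound k x) auto
    finally show ?thesis by (simp add: mult_ac)
  qed
  have i0: "integrable M (\<lambda>x. e x * r x)"
  proof (rule integrable_bounded)
    fix x assume x: "x \<in> space M"
    show "norm (e x * r x) \<le> \<bar>u\<bar> ^ 3 * B / 6 * B\<^sup>2"
      using r_le[OF x] B_nonneg mult_left_mono[OF d_square_bound[OF k x], of "\<bar>u\<bar> ^ 3 * B / 6"]
      by (simp add: norm_mult)
  qed measurable
  have i1: "integrable M (\<lambda>x. e x * complex_of_real (d k x))"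
    by (rule integrable_bounded[where B = B]) (auto simp: norm_mult intro: d_bound k)
  have i2: "integrable M (\<lambda>x. e x * complex_of_real ((d k x)\<^sup>2 - \<sigma> k))"
  proof (rule integrable_bounded)
    fix x assume x: "x \<in> space M"
    show "norm (e x * complex_of_real ((d k x)\<^sup>2 - \<sigma> k)) \<le> B\<^sup>2"
      using d_square_bound[OF k x] \<sigma>_le[OF k] \<sigma>_nonneg[of k] zero_le_power2[of "d k x"]
      unfolding norm_mult e1 norm_of_real mult_1_left abs_le_iff by linarith
  qed measurable
  define c where "c = 1 - u\<^sup>2 * \<sigma> k / 2"
  have decomp: "iexp (u * psum (Suc k) x) = complex_of_real c * e x + e x * r x +
      (\<i> * complex_of_real u) * (e x * complex_of_real (d k x)) -
      complex_of_real (u\<^sup>2 / 2) * (e x * complex_of_real ((d k x)\<^sup>2 - \<sigma> k))" for x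
  proof -
    have "iexp (u * psum (Suc k) x) = e x * iexp (u * d k x)"
      by (simp add: e_def psum_Suc distrib_left exp_add)
    also have "iexp (u * d k x) = r x + (1 + \<i> * complex_of_real (u * d k x) - complex_of_real ((u * d k x)\<^sup>2 / 2))"
      by (simp add: r_def)
    finally show ?thesis
      by (simp add: c_def algebra_simps power_mult_distrib diff_divide_distrib)
  qed
  have "expectation (\<lambda>x. iexp (u * psum (Suc k) x)) =
      complex_of_real c * expectation e + expectation (\<lambda>x. e x * r x) +
      (\<i> * complex_of_real u) * expectation (\<lambda>x. e x * complex_of_real (d k x)) -
      complex_of_real (u\<^sup>2 / 2) * expectation (\<lambda>x. e x * complex_of_real ((d k x)\<^sup>2 - \<sigma> k))"
    unfolding decomp
    by (simp only: Bochner_Integration.integral_diff Bochner_Integration.integral_add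
        integrable_mult_right Bochner_Integration.integrable_add integral_mult_right_zero ie i0 i1 i2)
  also have "expectation (\<lambda>x. e x * complex_of_real (d k x)) = 0"
    unfolding e_def by (rule iexp_martingale[OF k])
  finally have *: "expectation (\<lambda>x. iexp (u * psum (Suc k) x)) - complex_of_real (exp (- (u\<^sup>2 * \<sigma> k / 2))) * expectation e
     = complex_of_real (c - exp (- (u\<^sup>2 * \<sigma> k / 2))) * expectation e + expectation (\<lambda>x. e x * r x)
      - complex_of_real (u\<^sup>2 / 2) * expectation (\<lambda>x. e x * complex_of_real ((d k x)\<^sup>2 - \<sigma> k))"
    by (simp add: algebra_simps)
  have 1: "cmod (complex_of_real (c - exp (- (u\<^sup>2 * \<sigma> k / 2))) * expectation e) \<le> u ^ 4 * B\<^sup>2 / 8 * \<sigma> k"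
  proof -
    have "cmod (expectation e) \<le> 1"
      using norm_integral_le[OF ie, of "\<lambda>_. 1"] by (simp add: prob_space)
    moreover have "\<bar>c - exp (- (u\<^sup>2 * \<sigma> k / 2))\<bar> \<le> (u\<^sup>2 * \<sigma> k / 2)\<^sup>2 / 2"
      using exp_neg_quadratic_le[of "u\<^sup>2 * \<sigma> k / 2"] \<sigma>_nonneg[of k]
      by (simp add: c_def abs_minus_commute)
    ultimately have "cmod (complex_of_real (c - exp (- (u\<^sup>2 * \<sigma> k / 2))) * expectation e)
        \<le> (u\<^sup>2 * \<sigma> k / 2)\<^sup>2 / 2 * 1"
      unfolding norm_mult norm_of_real by (intro mult_mono) auto
    also have "\<dots> = u ^ 4 / 8 * \<sigma> k * \<sigma> k"
      by (simp add: power2_eq_square power4_eq_xxxx)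
    \<comment> \<open>One factor \<sigma>_k is traded for B^2, which keeps the error linear in
      \<sigma>_k and hence summable to s^2.\<close>
    also have "\<dots> \<le> u ^ 4 / 8 * \<sigma> k * B\<^sup>2"
      using \<sigma>_nonneg[of k] by (intro mult_left_mono \<sigma>_le k) auto
    finally show ?thesis by (simp add: mult_ac)
  qed
  have 2: "cmod (expectation (\<lambda>x. e x * r x)) \<le> \<bar>u\<bar> ^ 3 * B / 6 * \<sigma> k"
  proof -
    have "cmod (expectation (\<lambda>x. e x * r x)) \<le> expectation (\<lambda>x. \<bar>u\<bar> ^ 3 * B / 6 * (d k x)\<^sup>2)"
      by (rule norm_integral_le[OF i0])
        (use integrable_d_square[OF k] r_le in \<open>auto simp: norm_mult\<close>)
    then show ?thesis
      using integrable_d_square[OF k] by (simp add: \<sigma>_def)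
  qed
  have "cmod (expectation (\<lambda>x. iexp (u * psum (Suc k) x)) - complex_of_real (exp (- (u\<^sup>2 * \<sigma> k / 2))) * expectation e)
    \<le> cmod (complex_of_real (c - exp (- (u\<^sup>2 * \<sigma> k / 2))) * expectation e) + cmod (expectation (\<lambda>x. e x * r x))
      + u\<^sup>2 / 2 * cmod (expectation (\<lambda>x. e x * complex_of_real ((d k x)\<^sup>2 - \<sigma> k)))"
    unfolding * using norm_triangle_ineq4 norm_triangle_ineq
    by (smt (verit) norm_mult norm_of_real abs_of_nonneg zero_le_power2 divide_nonneg_pos)
  then show ?thesis
    using 1 2 unfolding e_def by linarith
qed

text \<open>With u = t/s, multiplying by the integrating factor exp(u^2 v_k / 2) turns the one-step
  comparison into a telescoping sum that starts at 1. Summing errors linear in \<sigma>_k produces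
  s^2, and u^3 s^2 is of order 1/s.\<close>

lemma char_bound:
  assumes s: "s > 0" "s\<^sup>2 = (\<Sum>k<N. \<sigma> k)"
  shows "cmod (expectation (\<lambda>x. iexp (t / s * psum N x)) - complex_of_real (exp (- (t\<^sup>2 / 2))))
    \<le> exp (t\<^sup>2 / 2) * (\<bar>t\<bar> ^ 3 * B / 6 / s + t ^ 4 * B\<^sup>2 / 8 / s\<^sup>2 + \<bar>t\<bar> ^ 3 * (1 + 2 * R) / (4 * (1 - q)) / s)"
proof -
  define u where "u = t / s"
  have us: "u\<^sup>2 * s\<^sup>2 = t\<^sup>2" using s(1) by (simp add: u_def power_divide)
  define v where "v k = (\<Sum>i<k. \<sigma> i)" for k
  define \<phi> where "\<phi> k = expectation (\<lambda>x. iexp (u * psum k x))" for k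
  define G where "G k = complex_of_real (exp (u\<^sup>2 * v k / 2)) * \<phi> k" for k
  define F where "F k = cmod (expectation (\<lambda>x. iexp (u * psum k x) * complex_of_real ((d k x)\<^sup>2 - \<sigma> k)))" for k
  have v_le: "v k \<le> s\<^sup>2" if "k \<le> N" for k
    unfolding v_def s by (intro sum_mono2) (use that \<sigma>_nonneg in auto)
  have G0: "G 0 = 1" by (simp add: G_def \<phi>_def v_def psum_def prob_space)
  have GN: "G N = complex_of_real (exp (t\<^sup>2 / 2)) * \<phi> N"
    using us s by (simp add: G_def v_def)
  have step: "cmod (G (Suc k) - G k) \<le> exp (t\<^sup>2 / 2) * (\<bar>u\<bar> ^ 3 * B / 6 * \<sigma> k + u ^ 4 * B\<^sup>2 / 8 * \<sigma> k + u\<^sup>2 / 2 * F k)"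
    if k: "k < N" for k
  proof -
    have "G (Suc k) - G k = complex_of_real (exp (u\<^sup>2 * v (Suc k) / 2)) *
        (\<phi> (Suc k) - complex_of_real (exp (- (u\<^sup>2 * \<sigma> k / 2))) * \<phi> k)"
    proof -
      have "exp (u\<^sup>2 * v k / 2) = exp (u\<^sup>2 * v (Suc k) / 2) * exp (- (u\<^sup>2 * \<sigma> k / 2))"
        unfolding exp_add[symmetric] by (simp add: v_def algebra_simps add_divide_distrib)
      then show ?thesis
        unfolding G_def by (simp add: algebra_simps del: of_real_exp exp_of_real)
    qed
    \<comment> \<open>The integrating factor grows with the partial variances and ends at exp(t^2 /
      2), because u^2 s^2 = t^2.\<close>
    moreover have "exp (u\<^sup>2 * v (Suc k) / 2) \<le> exp (t\<^sup>2 / 2)"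
      using mult_left_mono[OF v_le[of "Suc k"], of "u\<^sup>2"] k us by simp
    ultimately show ?thesis
      using char_step[OF k, of u] unfolding \<phi>_def F_def
      by (simp only: norm_mult norm_of_real abs_exp_cancel) (rule mult_mono, auto)
  qed
  have F_sum: "(\<Sum>k<N. F k) \<le> \<bar>u\<bar> * (1 + 2 * R) / (2 * (1 - q)) * s\<^sup>2"
  proof -
    have "(\<Sum>k<N. F k) \<le> (\<Sum>k<N. \<bar>u\<bar> / 2 * (\<Sum>j<k. q ^ (k - Suc j) * (\<sigma> j + 2 * R * \<sigma> k)))"
      unfolding F_def by (intro sum_mono variance_fluctuation) auto
    also have "\<dots> = \<bar>u\<bar> / 2 * ((\<Sum>k<N. \<Sum>j<k. q ^ (k - Suc j) * \<sigma> j) +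
        2 * R * (\<Sum>k<N. \<Sum>j<k. q ^ (k - Suc j) * \<sigma> k))"
      by (simp add: sum_distrib_left distrib_left sum.distrib mult_ac)
    also have "\<dots> \<le> \<bar>u\<bar> / 2 * ((\<Sum>k<N. \<sigma> k) / (1 - q) + 2 * R * ((\<Sum>k<N. \<sigma> k) / (1 - q)))"
      using q R_nonneg \<sigma>_nonneg
      by (intro mult_left_mono add_mono geometric_double_sum_le) auto
    also have "\<dots> = \<bar>u\<bar> * (1 + 2 * R) / (2 * (1 - q)) * s\<^sup>2"
    proof -
      have "a / 2 * (b / e + 2 * R * (b / e)) = a * (1 + 2 * R) / (2 * e) * b" for a b e :: real
        by (simp add: add_divide_distrib ring_distribs)
      then show ?thesis unfolding s .
    qed
    finally show ?thesis .
  qed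
  have "cmod (G N - 1) = cmod (\<Sum>k<N. G (Suc k) - G k)"
    using G0 by (simp add: sum_lessThan_telescope)
  also have "\<dots> \<le> (\<Sum>k<N. exp (t\<^sup>2 / 2) * (\<bar>u\<bar> ^ 3 * B / 6 * \<sigma> k + u ^ 4 * B\<^sup>2 / 8 * \<sigma> k + u\<^sup>2 / 2 * F k))"
    by (rule order_trans[OF norm_sum sum_mono], rule step) simp
  also have "\<dots> = exp (t\<^sup>2 / 2) * (\<bar>u\<bar> ^ 3 * B / 6 * s\<^sup>2 + u ^ 4 * B\<^sup>2 / 8 * s\<^sup>2 + u\<^sup>2 / 2 * (\<Sum>k<N. F k))"
    unfolding s by (simp add: sum_distrib_left sum.distrib distrib_left)
  also have "\<dots> \<le> exp (t\<^sup>2 / 2) * (\<bar>u\<bar> ^ 3 * B / 6 * s\<^sup>2 + u ^ 4 * B\<^sup>2 / 8 * s\<^sup>2 +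
      u\<^sup>2 / 2 * (\<bar>u\<bar> * (1 + 2 * R) / (2 * (1 - q)) * s\<^sup>2))"
    by (intro mult_left_mono add_left_mono F_sum) auto
  also have "\<dots> = exp (t\<^sup>2 / 2) * (\<bar>t\<bar> ^ 3 * B / 6 / s + t ^ 4 * B\<^sup>2 / 8 / s\<^sup>2 + \<bar>t\<bar> ^ 3 * (1 + 2 * R) / (4 * (1 - q)) / s)"
  proof -
    have "\<bar>u\<bar> ^ 3 * s\<^sup>2 = \<bar>t\<bar> ^ 3 / s" "u ^ 4 * s\<^sup>2 = t ^ 4 / s\<^sup>2" "u\<^sup>2 * \<bar>u\<bar> * s\<^sup>2 = \<bar>t\<bar> ^ 3 / s"
      using s(1) by (simp_all add: u_def abs_divide power_divide power2_eq_square power3_eq_cube power4_eq_xxxx)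
    moreover have "\<bar>u\<bar> ^ 3 * B / 6 * s\<^sup>2 = (\<bar>u\<bar> ^ 3 * s\<^sup>2) * B / 6"
      "u ^ 4 * B\<^sup>2 / 8 * s\<^sup>2 = (u ^ 4 * s\<^sup>2) * B\<^sup>2 / 8"
      "u\<^sup>2 / 2 * (\<bar>u\<bar> * (1 + 2 * R) / (2 * (1 - q)) * s\<^sup>2) =
        (u\<^sup>2 * \<bar>u\<bar> * s\<^sup>2) * (1 + 2 * R) / (4 * (1 - q))"
      by (simp_all add: mult_ac)
    ultimately show ?thesis
      by (simp only: divide_divide_eq_left mult_ac times_divide_eq_left times_divide_eq_right)
  qed
  finally have GN1: "cmod (G N - 1) \<le> exp (t\<^sup>2 / 2) * (\<bar>t\<bar> ^ 3 * B / 6 / s + t ^ 4 * B\<^sup>2 / 8 / s\<^sup>2 + \<bar>t\<bar> ^ 3 * (1 + 2 * R) / (4 * (1 - q)) / s)" .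
  \<comment> \<open>Removing the final integrating factor multiplies the error by exp(-t^2 / 2) <=
    1.\<close>
  have "\<phi> N - complex_of_real (exp (- (t\<^sup>2 / 2))) = complex_of_real (exp (- (t\<^sup>2 / 2))) * (G N - 1)"
    unfolding GN by (simp add: algebra_simps flip: exp_add of_real_mult mult.assoc del: of_real_exp)
  then have "cmod (\<phi> N - complex_of_real (exp (- (t\<^sup>2 / 2)))) = exp (- (t\<^sup>2 / 2)) * cmod (G N - 1)"
    by (simp only: norm_mult norm_of_real abs_exp_cancel)
  also have "\<dots> \<le> 1 * cmod (G N - 1)"
    by (intro mult_right_mono) auto
  finally show ?thesis
    using GN1 unfolding \<phi>_def u_def by linarith
qed

end

section \<open>Kernels and oscillation\<close>

text \<open>Fubini for the indicator of the region 0 <= t <= f(x): integrating first in t gives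
  f(x), first in x gives the tail probability. Cutting t off at \<open>b\<close> leaves an interval
  of finite length over which tail probabilities of two measures can be compared.\<close>

lemma (in prob_space) layer_cake:
  assumes [measurable]: "f \<in> borel_measurable M"
    and f: "\<And>x. x \<in> space M \<Longrightarrow> 0 \<le> f x" "\<And>x. x \<in> space M \<Longrightarrow> f x \<le> b"
  shows "expectation f = (\<integral>t. indicator {0..b} t * prob {x\<in>space M. t \<le> f x} \<partial>lborel)"
    and "integrable lborel (\<lambda>t. indicator {0..b} t * prob {x\<in>space M. t \<le> f x})"
proof -
  interpret pair_sigma_finite M lborel ..
  define H where "H x t = (indicator {0..b} t * indicator {t. t \<le> f x} t :: real)" for x t
  have m [measurable]: "case_prod H \<in> borel_measurable (M \<Otimes>\<^sub>M lborel)"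
    unfolding H_def indicator_def by measurable
  have i: "integrable (M \<Otimes>\<^sub>M lborel) (case_prod H)"
  proof (rule Fubini_integrable)
    have "(\<integral>t. norm (case_prod H (x, t)) \<partial>lborel) = f x" if "x \<in> space M" for x
    proof -
      have "(\<lambda>t. norm (case_prod H (x, t))) = indicator {0..f x}"
        using f(2)[OF that] by (auto simp: H_def indicator_def)
      then show ?thesis using f(1)[OF that] by simp
    qed
    then show "integrable M (\<lambda>x. \<integral>t. norm (case_prod H (x, t)) \<partial>lborel)"
      using f by (subst Bochner_Integration.integrable_cong[OF refl, where g = f])
        (auto intro!: integrable_bounded[where B = b])
    show "AE x in M. integrable lborel (\<lambda>t. case_prod H (x, t))"
    proof (rule AE_I2)
      fix x assume "x \<in> space M"
      then have "(\<lambda>t. case_prod H (x, t)) = indicator {0..f x}"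
        using f(2) by (fastforce simp: H_def indicator_def)
      then show "integrable lborel (\<lambda>t. case_prod H (x, t))"
        by (simp add: integrable_indicator_iff emeasure_lborel_Icc_eq)
    qed
  qed measurable
  have x: "(\<integral>t. H x t \<partial>lborel) = f x" if "x \<in> space M" for x
  proof -
    have "H x = indicator {0..f x}"
      using f(2)[OF that] by (auto simp: H_def indicator_def fun_eq_iff)
    then show ?thesis using f(1)[OF that] by simp
  qed
  have t: "expectation (\<lambda>x. H x t) = indicator {0..b} t * prob {x\<in>space M. t \<le> f x}" for t
  proof -
    have "expectation (\<lambda>x. H x t) = expectation (\<lambda>x. indicator {0..b} t * indicator {x\<in>space M. t \<le> f x} x)"
      by (rule Bochner_Integration.integral_cong) (auto simp: H_def indicator_def)
    then show ?thesis by simp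
  qed
  show "expectation f = (\<integral>t. indicator {0..b} t * prob {x\<in>space M. t \<le> f x} \<partial>lborel)"
    using Fubini_integral[OF i] x t by (simp cong: Bochner_Integration.integral_cong)
  show "integrable lborel (\<lambda>t. indicator {0..b} t * prob {x\<in>space M. t \<le> f x})"
    using integrable_snd[OF i] t by simp
qed

text \<open>After subtracting its infimum, f takes values in [0, b]. By the layer-cake formula the
  two integrals differ by an integral over [0, b] of differences of probabilities of superlevel
  sets, each at most \<delta>. Working with sets gives the constant \<delta> itself, without a
  factor 2.\<close>

lemma expectation_diff_le_oscillation:
  fixes f :: "'a \<Rightarrow> real"
  assumes P: "prob_space P" "sets P = sets E" and Q: "prob_space Q" "sets Q = sets E"
    and \<delta>: "\<And>A. A \<in> sets E \<Longrightarrow> \<bar>measure P A - measure Q A\<bar> \<le> \<delta>"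
    and [measurable]: "f \<in> borel_measurable E"
    and osc: "\<And>x y. x \<in> space E \<Longrightarrow> y \<in> space E \<Longrightarrow> \<bar>f x - f y\<bar> \<le> b"
  shows "\<bar>(\<integral>x. f x \<partial>P) - (\<integral>x. f x \<partial>Q)\<bar> \<le> \<delta> * b"
proof -
  interpret P: prob_space P by fact
  interpret Q: prob_space Q by fact
  have sp: "space P = space E" "space Q = space E"
    using P(2) Q(2) sets_eq_imp_space_eq by blast+
  obtain x0 where x0: "x0 \<in> space E" using P.not_empty sp by auto
  have b: "0 \<le> b" using osc[OF x0 x0] by simp
  define a where "a = (INF x\<in>space E. f x)"
  have bdd: "bdd_below (f ` space E)"
    using osc[OF x0] by (intro bdd_belowI2[where m = "f x0 - b"]) (fastforce simp: abs_le_iff)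
  define g where "g x = f x - a" for x
  have g0: "0 \<le> g x" if "x \<in> space E" for x
    unfolding g_def a_def using cINF_lower[OF bdd that] by simp
  have gb: "g x \<le> b" if "x \<in> space E" for x
  proof -
    have "f x - b \<le> a"
      unfolding a_def using osc[OF that] x0 by (intro cINF_greatest) (auto simp: abs_le_iff algebra_simps)
    then show ?thesis by (simp add: g_def)
  qed
  have gE [measurable]: "g \<in> borel_measurable E" unfolding g_def by measurable
  have gP [measurable]: "g \<in> borel_measurable P" "g \<in> borel_measurable Q"
    unfolding measurable_cong_sets[OF P(2) refl] measurable_cong_sets[OF Q(2) refl] by (fact gE)+
  have LP: "P.expectation g = (\<integral>t. indicator {0..b} t * P.prob {x\<in>space E. t \<le> g x} \<partial>lborel)"
    "integrable lborel (\<lambda>t. indicator {0..b} t * P.prob {x\<in>space E. t \<le> g x})"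
    using P.layer_cake[OF gP(1), of b] g0 gb by (auto simp: sp)
  have LQ: "Q.expectation g = (\<integral>t. indicator {0..b} t * Q.prob {x\<in>space E. t \<le> g x} \<partial>lborel)"
    "integrable lborel (\<lambda>t. indicator {0..b} t * Q.prob {x\<in>space E. t \<le> g x})"
    using Q.layer_cake[OF gP(2), of b] g0 gb by (auto simp: sp)
  have "\<bar>P.expectation g - Q.expectation g\<bar> =
      norm (\<integral>t. indicator {0..b} t * P.prob {x\<in>space E. t \<le> g x} - indicator {0..b} t * Q.prob {x\<in>space E. t \<le> g x} \<partial>lborel)"
    unfolding LP(1) LQ(1) by (simp add: Bochner_Integration.integral_diff[OF LP(2) LQ(2)])
  also have "\<dots> \<le> (\<integral>t. norm (indicator {0..b} t * P.prob {x\<in>space E. t \<le> g x} - indicator {0..b} t * Q.prob {x\<in>space E. t \<le> g x}) \<partial>lborel)"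
    by (rule integral_norm_bound)
  also have "\<dots> \<le> (\<integral>t. \<delta> * indicator {0..b} t \<partial>lborel)"
  proof (rule integral_mono)
    show "integrable lborel (\<lambda>t. norm (indicator {0..b} t * P.prob {x\<in>space E. t \<le> g x} - indicator {0..b} t * Q.prob {x\<in>space E. t \<le> g x}))"
      using LP(2) LQ(2) by simp
    show "integrable lborel (\<lambda>t. \<delta> * indicator {0..b} t :: real)"
      by (simp add: integrable_indicator_iff emeasure_lborel_Icc_eq)
    fix t :: real
    have "{x\<in>space E. t \<le> g x} \<in> sets E" by measurable
    from \<delta>[OF this] show "norm (indicator {0..b} t * P.prob {x\<in>space E. t \<le> g x} - indicator {0..b} t * Q.prob {x\<in>space E. t \<le> g x}) \<le> \<delta> * indicator {0..b} t"
      by (auto simp: indicator_def)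
  qed
  also have "\<dots> = \<delta> * b" using b by simp
  finally have *: "\<bar>P.expectation g - Q.expectation g\<bar> \<le> \<delta> * b" .
  have "integrable P g" "integrable Q g"
    using g0 gb by (auto intro!: P.integrable_bounded[where B = b] Q.integrable_bounded[where B = b] simp: sp)
  then have "P.expectation f = P.expectation g + a" "Q.expectation f = Q.expectation g + a"
    using Bochner_Integration.integral_add[of P g "\<lambda>_. a"] Bochner_Integration.integral_add[of Q g "\<lambda>_. a"]
    by (simp_all add: g_def P.prob_space Q.prob_space)
  then show ?thesis using * by simp
qed

text \<open>The inner integral is that of f against the image of L x under y -> (x, y), and this
  image is itself a measurable kernel into the product space.\<close>

lemma integral_measurable_subprob_algebra2:
  fixes f :: "'a \<Rightarrow> 'b \<Rightarrow> real"
  assumes f [measurable]: "(\<lambda>(x, y). f x y) \<in> borel_measurable (M \<Otimes>\<^sub>M N)"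
    and L [measurable]: "L \<in> M \<rightarrow>\<^sub>M subprob_algebra N"
  shows "(\<lambda>x. \<integral>y. f x y \<partial>L x) \<in> borel_measurable M"
proof -
  note integral_measurable_subprob_algebra [measurable] measurable_distr2 [measurable]
  have "(\<lambda>x. \<integral>p. (\<lambda>(x, y). f x y) p \<partial>distr (L x) (M \<Otimes>\<^sub>M N) (\<lambda>y. (x, y))) \<in> borel_measurable M"
    by measurable
  then show ?thesis
  proof (rule measurable_cong[THEN iffD1, rotated])
    fix x assume x [measurable]: "x \<in> space M"
    have [measurable_cong]: "sets (L x) = sets N"
      using L x by (rule sets_kernel)
    show "(\<integral>p. (\<lambda>(x, y). f x y) p \<partial>distr (L x) (M \<Otimes>\<^sub>M N) (\<lambda>y. (x, y))) = (\<integral>y. f x y \<partial>L x)"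
      using measurable_Pair1'[OF x, of N] by (subst integral_distr) (auto simp: measurable_cong_sets[OF \<open>sets (L x) = sets N\<close> refl])
  qed
qed

section \<open>Conditional expectations along a path\<close>

text \<open>Adaptedness as a pointwise statement about coordinates instead of measurability for a
  sub-sigma-algebra. Conditional expectations are explicit kernel integrals here, so identities
  between them hold at every path and not merely almost everywhere.\<close>

definition depends_on :: "(nat \<Rightarrow> 'a) measure \<Rightarrow> nat set \<Rightarrow> ((nat \<Rightarrow> 'a) \<Rightarrow> real) \<Rightarrow> bool" where
  "depends_on P I F \<longleftrightarrow>
     (\<forall>x\<in>space P. \<forall>y\<in>space P. (\<forall>i\<in>I. x i = y i) \<longrightarrow> F x = F y)"

definition bounded_measurable :: "'a measure \<Rightarrow> real \<Rightarrow> ('a \<Rightarrow> real) \<Rightarrow> bool" where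
  "bounded_measurable P b F \<longleftrightarrow> F \<in> borel_measurable P \<and> (\<forall>x\<in>space P. \<bar>F x\<bar> \<le> b)"

section \<open>Calculus of coordinate dependence and boundedness\<close>

lemma depends_onD:
  "depends_on P I F \<Longrightarrow> x \<in> space P \<Longrightarrow> y \<in> space P \<Longrightarrow> (\<And>i. i \<in> I \<Longrightarrow> x i = y i) \<Longrightarrow> F x = F y"
  unfolding depends_on_def by blast

lemma depends_onI:
  "(\<And>x y. x \<in> space P \<Longrightarrow> y \<in> space P \<Longrightarrow> (\<And>i. i \<in> I \<Longrightarrow> x i = y i) \<Longrightarrow> F x = F y) \<Longrightarrow> depends_on P I F"
  unfolding depends_on_def by blast

lemma depends_on_mono: "depends_on P I F \<Longrightarrow> I \<subseteq> J \<Longrightarrow> depends_on P J F"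
  unfolding depends_on_def by blast

lemma depends_on_comp: "depends_on P I F \<Longrightarrow> depends_on P I (\<lambda>x. g (F x))"
  unfolding depends_on_def by metis

lemma depends_on_diff:
  "depends_on P I F \<Longrightarrow> depends_on P I G \<Longrightarrow> depends_on P I (\<lambda>x. F x - G x)"
  unfolding depends_on_def by metis

lemma bounded_measurable_measurable: "bounded_measurable P b F \<Longrightarrow> F \<in> borel_measurable P"
  by (simp add: bounded_measurable_def)

lemma bounded_measurable_bound: "bounded_measurable P b F \<Longrightarrow> x \<in> space P \<Longrightarrow> \<bar>F x\<bar> \<le> b"
  by (simp add: bounded_measurable_def)

lemma bounded_measurable_mult:
  assumes F: "bounded_measurable P b F" and G: "bounded_measurable P c G"
  shows "bounded_measurable P (b * c) (\<lambda>x. F x * G x)"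
  unfolding bounded_measurable_def
proof (intro conjI ballI)
  show "(\<lambda>x. F x * G x) \<in> borel_measurable P"
    by (intro borel_measurable_times bounded_measurable_measurable[OF F] bounded_measurable_measurable[OF G])
  fix x assume x: "x \<in> space P"
  show "\<bar>F x * G x\<bar> \<le> b * c"
    unfolding abs_mult
    using bounded_measurable_bound[OF F x] bounded_measurable_bound[OF G x]
    by (intro mult_mono) auto
qed

lemma bounded_measurable_sum:
  assumes "finite I" "\<And>i. i \<in> I \<Longrightarrow> bounded_measurable P b (F i)"
  shows "bounded_measurable P (real (card I) * b) (\<lambda>x. \<Sum>i\<in>I. F i x)"
  unfolding bounded_measurable_def
proof (intro conjI ballI)
  show "(\<lambda>x. \<Sum>i\<in>I. F i x) \<in> borel_measurable P"
    using assms by (intro borel_measurable_sum) (auto dest: bounded_measurable_measurable)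
  fix x assume x: "x \<in> space P"
  have "\<bar>\<Sum>i\<in>I. F i x\<bar> \<le> (\<Sum>i\<in>I. b)"
    by (rule order_trans[OF sum_abs sum_mono]) (use bounded_measurable_bound[OF assms(2) x] in auto)
  then show "\<bar>\<Sum>i\<in>I. F i x\<bar> \<le> real (card I) * b" by simp
qed

lemma (in prob_space) integrable_bounded_measurable: "bounded_measurable M b F \<Longrightarrow> integrable M F"
  by (rule integrable_bounded[where B = b]) (auto simp: bounded_measurable_def)

lemma (in prob_space) deviation_le_oscillation:
  fixes F :: "'a \<Rightarrow> real"
  assumes "integrable M F" "\<And>y. y \<in> space M \<Longrightarrow> \<bar>a - F y\<bar> \<le> b"
  shows "\<bar>a - expectation F\<bar> \<le> b"
proof -
  have "a - expectation F = expectation (\<lambda>y. a - F y)"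
    using assms by (simp add: prob_space)
  also have "norm \<dots> \<le> expectation (\<lambda>_. b)"
    by (rule norm_integral_le) (use assms in auto)
  finally show ?thesis by (simp add: prob_space)
qed

text \<open>Steps are numbered from 0, where \<open>\<kappa> 0\<close> draws the first coordinate.
  The kernels take a whole path, with \<open>\<kappa>_local\<close> restricting them to the current
  coordinate. The Markov property enters only in integrated form: redrawing coordinate
  \<open>Suc k\<close> from its kernel does not change the mean of a function of the coordinates up
  to \<open>Suc k\<close>. Contraction is available only for steps below \<open>n\<close>.\<close>

locale path_chain = prob_space \<mu> for \<mu> :: "(nat \<Rightarrow> 'a) measure" +
  fixes E :: "'a measure" and N n :: nat and \<kappa> :: "nat \<Rightarrow> (nat \<Rightarrow> 'a) \<Rightarrow> 'a measure" and \<rho> :: real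
  assumes sets_\<mu>: "sets \<mu> = sets (\<Pi>\<^sub>M i\<in>{1..N}. E)"
    and \<kappa>_measurable: "\<And>k. k < N \<Longrightarrow> \<kappa> k \<in> \<mu> \<rightarrow>\<^sub>M prob_algebra E"
    and \<kappa>_local: "\<And>k x y. k < N \<Longrightarrow> x \<in> space \<mu> \<Longrightarrow> y \<in> space \<mu> \<Longrightarrow> x k = y k \<Longrightarrow> \<kappa> k x = \<kappa> k y"
    and \<kappa>_step: "\<And>k b F. k < N \<Longrightarrow> bounded_measurable \<mu> b F \<Longrightarrow> depends_on \<mu> {..Suc k} F \<Longrightarrow>
      expectation (\<lambda>x. \<integral>y. F (x(Suc k := y)) \<partial>\<kappa> k x) = expectation F"
    and \<kappa>_contraction: "\<And>k x y A. k < N \<Longrightarrow> k < n \<Longrightarrow> x \<in> space \<mu> \<Longrightarrow> y \<in> space \<mu> \<Longrightarrow> A \<in> sets E \<Longrightarrow>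
      \<bar>measure (\<kappa> k x) A - measure (\<kappa> k y) A\<bar> \<le> \<rho>"
    and \<rho>: "0 \<le> \<rho>" "\<rho> < 1"
begin

text \<open>For F depending on the coordinates up to \<open>Suc k\<close>, this is a version of the
  conditional expectation given the coordinates up to \<open>k\<close>.\<close>

definition T :: "nat \<Rightarrow> ((nat \<Rightarrow> 'a) \<Rightarrow> real) \<Rightarrow> (nat \<Rightarrow> 'a) \<Rightarrow> real" where
  "T k F x = (\<integral>y. F (x(Suc k := y)) \<partial>\<kappa> k x)"

text \<open>\<open>Q k F\<close> is a version of the conditional expectation of \<open>F\<close> given the coordinates
  \<open>1, \<dots>, k\<close>.\<close>

definition Q :: "nat \<Rightarrow> ((nat \<Rightarrow> 'a) \<Rightarrow> real) \<Rightarrow> (nat \<Rightarrow> 'a) \<Rightarrow> real" where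
  "Q k F = foldr T [k..<N] F"

section \<open>Path updates and the one-step kernel operator\<close>

lemma space_\<mu>: "space \<mu> = {1..N} \<rightarrow>\<^sub>E space E"
  using sets_eq_imp_space_eq[OF sets_\<mu>] by (simp add: space_PiM)

lemma upd_space: "k < N \<Longrightarrow> x \<in> space \<mu> \<Longrightarrow> y \<in> space E \<Longrightarrow> x(Suc k := y) \<in> space \<mu>"
  unfolding space_\<mu> by (auto simp: PiE_iff extensional_def)

lemma coord_outside: "x \<in> space \<mu> \<Longrightarrow> i \<notin> {1..N} \<Longrightarrow> x i = undefined"
  unfolding space_\<mu> by (auto simp: PiE_iff extensional_def)

lemma upd_measurable:
  assumes "k < N"
  shows "(\<lambda>(x, y). x(Suc k := y)) \<in> \<mu> \<Otimes>\<^sub>M E \<rightarrow>\<^sub>M \<mu>"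
proof -
  have "(\<lambda>p. (fst p)(Suc k := snd p)) \<in> \<mu> \<Otimes>\<^sub>M E \<rightarrow>\<^sub>M (\<Pi>\<^sub>M i\<in>{1..N}. E)"
  proof (rule measurable_fun_upd)
    show "{1..N} = {1..N} \<union> {Suc k}" using assms by auto
    show "fst \<in> \<mu> \<Otimes>\<^sub>M E \<rightarrow>\<^sub>M (\<Pi>\<^sub>M i\<in>{1..N}. E)"
      unfolding measurable_cong_sets[OF refl sets_\<mu>[symmetric]] by (rule measurable_fst)
  qed (rule measurable_snd)
  then show ?thesis
    unfolding measurable_cong_sets[OF refl sets_\<mu>] split_beta' .
qed

lemma \<kappa>_prob: "k < N \<Longrightarrow> x \<in> space \<mu> \<Longrightarrow> prob_space (\<kappa> k x)"
  and \<kappa>_sets: "k < N \<Longrightarrow> x \<in> space \<mu> \<Longrightarrow> sets (\<kappa> k x) = sets E"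
  using measurable_space[OF \<kappa>_measurable] by (auto simp: space_prob_algebra)

lemma \<kappa>_space: "k < N \<Longrightarrow> x \<in> space \<mu> \<Longrightarrow> space (\<kappa> k x) = space E"
  using \<kappa>_sets sets_eq_imp_space_eq by blast

lemma section_measurable:
  assumes k: "k < N" and x: "x \<in> space \<mu>" and F: "F \<in> borel_measurable \<mu>"
  shows "(\<lambda>y. F (x(Suc k := y))) \<in> borel_measurable E"
  using measurable_compose[OF measurable_compose[OF measurable_Pair1'[OF x] upd_measurable[OF k]] F]
  by simp

lemma section_bounded:
  assumes k: "k < N" and x: "x \<in> space \<mu>" and F: "bounded_measurable \<mu> b F"
  shows "bounded_measurable (\<kappa> k x) b (\<lambda>y. F (x(Suc k := y)))"
  using section_measurable[OF k x] F upd_space[OF k x]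
  unfolding bounded_measurable_def measurable_cong_sets[OF \<kappa>_sets[OF k x] refl] \<kappa>_space[OF k x]
  by auto

lemma section_integrable:
  assumes "k < N" "x \<in> space \<mu>" "bounded_measurable \<mu> b F"
  shows "integrable (\<kappa> k x) (\<lambda>y. F (x(Suc k := y)))"
  by (rule prob_space.integrable_bounded_measurable[OF \<kappa>_prob section_bounded]) (use assms in auto)

lemma T_cong:
  assumes "k < N" "x \<in> space \<mu>" "\<And>x. x \<in> space \<mu> \<Longrightarrow> F x = G x"
  shows "T k F x = T k G x"
  unfolding T_def
  by (rule Bochner_Integration.integral_cong) (use assms upd_space \<kappa>_space in auto)

lemma T_bounded_measurable:
  assumes k: "k < N" and F: "bounded_measurable \<mu> b F"
  shows "bounded_measurable \<mu> b (T k F)"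
  unfolding bounded_measurable_def
proof (intro conjI ballI)
  have "(\<lambda>(x, y). F (x(Suc k := y))) \<in> borel_measurable (\<mu> \<Otimes>\<^sub>M E)"
    using measurable_compose[OF upd_measurable[OF k] bounded_measurable_measurable[OF F]]
    by (simp add: split_beta')
  then show "T k F \<in> borel_measurable \<mu>"
    unfolding T_def
    by (intro integral_measurable_subprob_algebra2[where N = E] measurable_prob_algebraD \<kappa>_measurable k)
  fix x assume x: "x \<in> space \<mu>"
  interpret K: prob_space "\<kappa> k x" by (rule \<kappa>_prob[OF k x])
  have "norm (T k F x) \<le> K.expectation (\<lambda>_. b)"
    unfolding T_def
    by (rule norm_integral_le[OF section_integrable[OF k x F]])
      (use bounded_measurable_bound[OF section_bounded[OF k x F]] in auto)
  then show "\<bar>T k F x\<bar> \<le> b" by (simp add: K.prob_space)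
qed

lemma T_pull_out:
  assumes k: "k < N" and x: "x \<in> space \<mu>" and Y: "depends_on \<mu> {..k} Y"
  shows "T k (\<lambda>x. Y x * F x) x = Y x * T k F x"
proof -
  have "T k (\<lambda>x. Y x * F x) x = (\<integral>y. Y x * F (x(Suc k := y)) \<partial>\<kappa> k x)"
    unfolding T_def
  proof (rule Bochner_Integration.integral_cong[OF refl])
    fix y assume "y \<in> space (\<kappa> k x)"
    then have "x(Suc k := y) \<in> space \<mu>" using upd_space[OF k x] \<kappa>_space[OF k x] by simp
    then have "Y (x(Suc k := y)) = Y x"
      by (rule depends_onD[OF Y _ x]) auto
    then show "Y (x(Suc k := y)) * F (x(Suc k := y)) = Y x * F (x(Suc k := y))" by simp
  qed
  then show ?thesis by (simp add: T_def)
qed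

section \<open>Iterated kernel integrals as conditional expectations\<close>

lemma Q_beyond: "N \<le> k \<Longrightarrow> Q k F = F"
  by (simp add: Q_def)

lemma Q_step: "k < N \<Longrightarrow> Q k F = T k (Q (Suc k) F)"
  by (simp add: Q_def upt_conv_Cons)

lemma Q_bounded_measurable:
  assumes F: "bounded_measurable \<mu> b F"
  shows "bounded_measurable \<mu> b (Q k F)"
proof (cases "k \<le> N")
  case True
  then show ?thesis
    by (induction k rule: inc_induct) (simp_all add: Q_beyond F Q_step T_bounded_measurable)
qed (simp add: Q_beyond F)

lemma Q_measurable: "bounded_measurable \<mu> b F \<Longrightarrow> Q k F \<in> borel_measurable \<mu>"
  by (rule bounded_measurable_measurable[OF Q_bounded_measurable])

text \<open>The Markov property: for k <= l the future from l on influences \<open>Q k F\<close>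
  through the single coordinate k. Backward induction, where each integration removes coordinate k+1
  and the kernel introduces coordinate k.\<close>

lemma Q_depends:
  assumes "k \<le> N" and F: "depends_on \<mu> {l..} F"
  shows "depends_on \<mu> {min l k..k} (Q k F)"
  using assms(1)
proof (induction k rule: inc_induct)
  case base
  \<comment> \<open>Coordinates beyond N carry the same default value \<open>undefined\<close> on
    all paths, so agreement up to N is enough.\<close>
  have "F x = F y"
    if "x \<in> space \<mu>" "y \<in> space \<mu>" "\<And>i. i \<in> {min l N..N} \<Longrightarrow> x i = y i" for x y
  proof (rule depends_onD[OF F that(1,2)])
    fix i assume "i \<in> {l..}"
    then show "x i = y i"
      using that(3)[of i] coord_outside[OF that(1), of i] coord_outside[OF that(2), of i]
      by (cases "i \<le> N") auto
  qed
  then have "depends_on \<mu> {min l N..N} F"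
    by (rule depends_onI)
  then show ?case by (simp add: Q_beyond)
next
  case (step k)
  show ?case
  proof (rule depends_onI)
    fix x y assume x: "x \<in> space \<mu>" and y: "y \<in> space \<mu>"
      and eq: "\<And>i. i \<in> {min l k..k} \<Longrightarrow> x i = y i"
    have \<kappa>: "\<kappa> k x = \<kappa> k y"
      using \<kappa>_local[OF step(2) x y] eq by auto
    show "Q k F x = Q k F y"
      unfolding Q_step[OF step(2)] T_def \<kappa>
    proof (rule Bochner_Integration.integral_cong[OF refl])
      fix z assume "z \<in> space (\<kappa> k y)"
      then have z: "z \<in> space E" using \<kappa>_space[OF step(2) y] by simp
      show "Q (Suc k) F (x(Suc k := z)) = Q (Suc k) F (y(Suc k := z))"
        by (rule depends_onD[OF step(3) upd_space[OF step(2) x z] upd_space[OF step(2) y z]])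
          (auto intro!: eq)
    qed
  qed
qed

lemma Q_adapted:
  assumes "k \<le> N"
  shows "depends_on \<mu> {..k} (Q k F)"
proof -
  have "depends_on \<mu> {0..} F"
    unfolding depends_on_def by (auto intro!: arg_cong[where f = F])
  from Q_depends[OF assms this] show ?thesis
    by (rule depends_on_mono) auto
qed

lemma Q_pull_out:
  assumes "j \<le> k" "k \<le> N" "x \<in> space \<mu>" and Y: "depends_on \<mu> {..j} Y"
  shows "Q k (\<lambda>x. Y x * F x) x = Y x * Q k F x"
  using assms(2,1,3)
proof (induction k arbitrary: x rule: inc_induct)
  case base
  then show ?case by (simp add: Q_beyond)
next
  case (step k)
  have "Q k (\<lambda>x. Y x * F x) x = T k (\<lambda>x. Y x * Q (Suc k) F x) x"
    unfolding Q_step[OF step(2)] using step by (intro T_cong) auto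
  also have "\<dots> = Y x * T k (Q (Suc k) F) x"
    using step by (intro T_pull_out depends_on_mono[OF Y]) auto
  finally show ?case by (simp add: Q_step[OF step(2)])
qed

lemma Q_const:
  assumes "k \<le> N" "x \<in> space \<mu>"
  shows "Q k (\<lambda>_. c) x = c"
  using assms
proof (induction k arbitrary: x rule: inc_induct)
  case (step k)
  have "Q k (\<lambda>_. c) x = T k (\<lambda>_. c) x"
    unfolding Q_step[OF step(2)] using step by (intro T_cong) auto
  then show ?case
    using prob_space.prob_space[OF \<kappa>_prob[OF step(2,4)]] by (simp add: T_def)
qed (simp add: Q_beyond)

lemma Q_of_adapted:
  assumes "k \<le> N" "x \<in> space \<mu>" "depends_on \<mu> {..k} F"
  shows "Q k F x = F x"
  using Q_pull_out[OF order_refl assms, of "\<lambda>_. 1"] assms by (simp add: Q_const)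

text \<open>Backward induction through \<open>\<kappa>_step\<close>, which applies because
  \<open>Q (Suc k) F\<close> is a function of the coordinates up to \<open>Suc k\<close>.\<close>

lemma Q_expectation:
  assumes "k \<le> N" and F: "bounded_measurable \<mu> b F"
  shows "expectation (Q k F) = expectation F"
  using assms(1)
proof (induction k rule: inc_induct)
  case (step k)
  then show ?case
    using \<kappa>_step[OF step(2) Q_bounded_measurable[OF F] Q_adapted[of "Suc k" F]]
    by (simp add: Q_step[OF step(2)] T_def[abs_def])
qed (simp add: Q_beyond)

text \<open>Together with \<open>Q_adapted\<close> this is the characterisation of conditional
  expectation by bounded adapted test functions; all orthogonality below rests on it.\<close>

lemma Q_expectation_mult:
  assumes k: "k \<le> N" and Y: "bounded_measurable \<mu> c Y" "depends_on \<mu> {..k} Y"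
    and F: "bounded_measurable \<mu> b F"
  shows "expectation (\<lambda>x. Y x * Q k F x) = expectation (\<lambda>x. Y x * F x)"
proof -
  have "expectation (\<lambda>x. Y x * Q k F x) = expectation (Q k (\<lambda>x. Y x * F x))"
    by (rule Bochner_Integration.integral_cong) (simp_all add: Q_pull_out[OF order_refl k _ Y(2)])
  also have "\<dots> = expectation (\<lambda>x. Y x * F x)"
    by (rule Q_expectation[OF k bounded_measurable_mult[OF Y(1) F]])
  finally show ?thesis .
qed

lemma Q_nonneg:
  assumes "k \<le> N" "x \<in> space \<mu>" "\<And>x. x \<in> space \<mu> \<Longrightarrow> 0 \<le> F x"
  shows "0 \<le> Q k F x"
  using assms(1,2)
proof (induction k arbitrary: x rule: inc_induct)
  case base
  then show ?case by (simp add: Q_beyond assms(3))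
next
  case (step k)
  then show ?case
    unfolding Q_step[OF step(2)] T_def
    by (intro Bochner_Integration.integral_nonneg step(3) upd_space) (auto simp: \<kappa>_space)
qed

lemma Q_sum:
  assumes "k \<le> N" "x \<in> space \<mu>" "finite I" "\<And>i. i \<in> I \<Longrightarrow> bounded_measurable \<mu> b (F i)"
  shows "Q k (\<lambda>x. \<Sum>i\<in>I. F i x) x = (\<Sum>i\<in>I. Q k (F i) x)"
  using assms(1,2)
proof (induction k arbitrary: x rule: inc_induct)
  case base
  then show ?case by (simp add: Q_beyond)
next
  case (step k)
  have "Q k (\<lambda>x. \<Sum>i\<in>I. F i x) x = T k (\<lambda>x. \<Sum>i\<in>I. Q (Suc k) (F i) x) x"
    unfolding Q_step[OF step(2)] using step by (intro T_cong) auto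
  also have "\<dots> = (\<Sum>i\<in>I. T k (Q (Suc k) (F i)) x)"
    unfolding T_def
    using section_integrable[OF step(2,4) Q_bounded_measurable] assms(4)
    by (intro Bochner_Integration.integral_sum) auto
  finally show ?case by (simp add: Q_step[OF step(2)])
qed

text \<open>For k < l, \<open>Q (Suc k) F\<close> is a function of coordinate k+1 alone, so
  \<open>Q k F\<close> at two paths integrates the same function against two kernel measures, and
  the oscillation shrinks by \<rho>. As l <= n, every step used contracts. For k >= l the truncated
  exponent is 0 and the trivial bound 2b remains.\<close>

lemma Q_oscillation:
  assumes F: "bounded_measurable \<mu> b F" "depends_on \<mu> {l..} F" and l: "l \<le> n" "l \<le> N"
    and x: "x \<in> space \<mu>" "y \<in> space \<mu>"
  shows "\<bar>Q k F x - Q k F y\<bar> \<le> \<rho> ^ (l - k) * (2 * b)"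
proof -
  have triv: "\<bar>Q k F x - Q k F y\<bar> \<le> 2 * b" if "x \<in> space \<mu>" "y \<in> space \<mu>" for k x y
    using bounded_measurable_bound[OF Q_bounded_measurable[OF F(1)], of _ k] that
    by (smt (verit))
  show ?thesis
  proof (cases "k \<le> l")
    case True
    then show ?thesis using x
    proof (induction k arbitrary: x y rule: inc_induct)
      case base
      then show ?case using triv by simp
    next
      case (step k)
      have k: "k < N" using step l by simp
      have dep: "depends_on \<mu> {Suc k} (Q (Suc k) F)"
        using Q_depends[OF _ F(2), of "Suc k"] k step(2) by (simp add: min_absorb2)
      \<comment> \<open>The past of \<open>y\<close> is exchanged for that of \<open>x\<close>
        inside the integrand; only the measure still remembers \<open>y\<close>.\<close>
      have "Q k F y = (\<integral>z. Q (Suc k) F (x(Suc k := z)) \<partial>\<kappa> k y)"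
        unfolding Q_step[OF k] T_def
      proof (rule Bochner_Integration.integral_cong[OF refl])
        fix z assume "z \<in> space (\<kappa> k y)"
        then have "z \<in> space E" using \<kappa>_space k step by simp
        then show "Q (Suc k) F (y(Suc k := z)) = Q (Suc k) F (x(Suc k := z))"
          using step k by (intro depends_onD[OF dep] upd_space) auto
      qed
      moreover have "\<bar>(\<integral>z. Q (Suc k) F (x(Suc k := z)) \<partial>\<kappa> k x) - (\<integral>z. Q (Suc k) F (x(Suc k := z)) \<partial>\<kappa> k y)\<bar>
          \<le> \<rho> * (\<rho> ^ (l - Suc k) * (2 * b))"
      proof (rule expectation_diff_le_oscillation)
        show "prob_space (\<kappa> k x)" "prob_space (\<kappa> k y)" "sets (\<kappa> k x) = sets E" "sets (\<kappa> k y) = sets E"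
          using \<kappa>_prob[OF k] \<kappa>_sets[OF k] step(4,5) by auto
        show "\<bar>measure (\<kappa> k x) A - measure (\<kappa> k y) A\<bar> \<le> \<rho>" if "A \<in> sets E" for A
          using \<kappa>_contraction[OF k _ step(4,5) that] step(2) l by simp
        show "(\<lambda>z. Q (Suc k) F (x(Suc k := z))) \<in> borel_measurable E"
          by (rule section_measurable[OF k step(4) Q_measurable[OF F(1)]])
        show "\<bar>Q (Suc k) F (x(Suc k := z)) - Q (Suc k) F (x(Suc k := z'))\<bar> \<le> \<rho> ^ (l - Suc k) * (2 * b)"
          if "z \<in> space E" "z' \<in> space E" for z z'
          by (rule step(3)[OF upd_space[OF k step(4) that(1)] upd_space[OF k step(4) that(2)]])
      qed
      moreover have "\<rho> * (\<rho> ^ (l - Suc k) * (2 * b)) = \<rho> ^ (l - k) * (2 * b)"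
        unfolding mult.assoc[symmetric] power_Suc[symmetric] using step(2) by (simp only: Suc_diff_Suc)
      ultimately show ?case
        unfolding Q_step[OF k] T_def by (simp only:)
    qed
  next
    case False
    then show ?thesis using triv x by simp
  qed
qed

text \<open>\<open>Q k F x\<close> is an average of \<open>Q (Suc k) F\<close> over paths that
  differ from x in one coordinate, so the increment is at most the oscillation at time k+1.\<close>

lemma Q_increment:
  assumes k: "k < N" and F: "bounded_measurable \<mu> b F" "depends_on \<mu> {l..} F" and l: "l \<le> n" "l \<le> N"
    and x: "x \<in> space \<mu>"
  shows "\<bar>Q (Suc k) F x - Q k F x\<bar> \<le> \<rho> ^ (l - Suc k) * (2 * b)"
proof -
  have "\<bar>Q (Suc k) F x - (\<integral>y. Q (Suc k) F (x(Suc k := y)) \<partial>\<kappa> k x)\<bar> \<le> \<rho> ^ (l - Suc k) * (2 * b)"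
  proof (rule prob_space.deviation_le_oscillation[OF \<kappa>_prob[OF k x]])
    show "integrable (\<kappa> k x) (\<lambda>y. Q (Suc k) F (x(Suc k := y)))"
      by (rule section_integrable[OF k x Q_bounded_measurable[OF F(1)]])
    fix y assume "y \<in> space (\<kappa> k x)"
    then have "x(Suc k := y) \<in> space \<mu>"
      using upd_space[OF k x] \<kappa>_space[OF k x] by simp
    then show "\<bar>Q (Suc k) F x - Q (Suc k) F (x(Suc k := y))\<bar> \<le> \<rho> ^ (l - Suc k) * (2 * b)"
      by (rule Q_oscillation[OF F l x])
  qed
  then show ?thesis by (simp only: Q_step[OF k] T_def)
qed

end

section \<open>Sums of block functions\<close>

text \<open>The bound of \<open>mixing_martingale.char_bound\<close> with q = sqrt r and R = 2 B^2 /
  r^m. Taking the maximum with 1/2 keeps r positive when \<rho> = 0, so that dividing by r^m makes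
  sense, and still leaves r < 1 for \<rho> < 1.\<close>

definition clt_error :: "real \<Rightarrow> nat \<Rightarrow> real \<Rightarrow> real \<Rightarrow> real \<Rightarrow> real" where
  "clt_error \<rho> m C t s =
    (let B = 2 * C * (real m + 1 / (1 - \<rho>)); r = max \<rho> (1 / 2)
     in exp (t\<^sup>2 / 2) * (\<bar>t\<bar> ^ 3 * B / 6 / s + t ^ 4 * B\<^sup>2 / 8 / s\<^sup>2 +
        \<bar>t\<bar> ^ 3 * (1 + 2 * (2 * B\<^sup>2 / r ^ m)) / (4 * (1 - sqrt r)) / s))"

lemma clt_error_tendsto_0:
  assumes s: "filterlim s at_top F"
  shows "((\<lambda>x. clt_error \<rho> m C t (s x)) \<longlongrightarrow> 0) F"
proof -
  have lim: "((\<lambda>x. a / s x) \<longlongrightarrow> 0) F" "((\<lambda>x. a / (s x)\<^sup>2) \<longlongrightarrow> 0) F" for a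
    by (rule real_tendsto_divide_at_top[OF tendsto_const]; (intro filterlim_pow_at_top s)?; simp)+
  show ?thesis
    unfolding clt_error_def Let_def
    by (intro tendsto_mult_right_zero tendsto_add_zero lim)
qed

locale block_chain = path_chain +
  fixes m :: nat and Z :: "nat \<Rightarrow> (nat \<Rightarrow> 'a) \<Rightarrow> real" and C :: real
  assumes N: "N = n + m"
    and Z_bounded: "\<And>i. i \<in> {1..n} \<Longrightarrow> bounded_measurable \<mu> C (Z i)"
    and Z_depends: "\<And>i. i \<in> {1..n} \<Longrightarrow> depends_on \<mu> {i..i + m} (Z i)"
    and C_nonneg: "0 \<le> C"
begin

definition S :: "(nat \<Rightarrow> 'a) \<Rightarrow> real" where "S x = (\<Sum>i\<in>{1..n}. Z i x)"

definition D :: "nat \<Rightarrow> (nat \<Rightarrow> 'a) \<Rightarrow> real" where "D k x = Q (Suc k) S x - Q k S x"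

definition B :: real where "B = 2 * C * (real m + 1 / (1 - \<rho>))"

definition r :: real where "r = max \<rho> (1 / 2)"

definition H :: "nat \<Rightarrow> nat \<Rightarrow> (nat \<Rightarrow> 'a) \<Rightarrow> real" where
  "H j k x = Q j (\<lambda>y. (D k y)\<^sup>2) x - expectation (\<lambda>y. (D k y)\<^sup>2)"

section \<open>Martingale differences of the block sum and their mixing\<close>

lemma S_bounded: "bounded_measurable \<mu> (real n * C) S"
  using bounded_measurable_sum[of "{1..n}" \<mu> C Z] Z_bounded by (simp add: S_def[abs_def])

lemma D_eq_sum:
  assumes "k < N" "x \<in> space \<mu>"
  shows "D k x = (\<Sum>i\<in>{1..n}. Q (Suc k) (Z i) x - Q k (Z i) x)"
proof -
  have "Q j S x = (\<Sum>i\<in>{1..n}. Q j (Z i) x)" if "j \<le> N" for j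
    unfolding S_def[abs_def] by (rule Q_sum) (use that assms Z_bounded in auto)
  then show ?thesis using assms by (simp add: D_def sum_subtractf)
qed

lemma increment_eq_0:
  assumes "k < N" "x \<in> space \<mu>" "i \<in> {1..n}" "i + m \<le> k"
  shows "Q (Suc k) (Z i) x - Q k (Z i) x = 0"
  using assms Q_of_adapted[of k x "Z i"] Q_of_adapted[of "Suc k" x "Z i"]
    depends_on_mono[OF Z_depends[OF assms(3)], of "{..k}"]
    depends_on_mono[OF Z_depends[OF assms(3)], of "{..Suc k}"]
  by auto

lemma Z_depends_from: "i \<in> {1..n} \<Longrightarrow> depends_on \<mu> {i..} (Z i)"
  by (rule depends_on_mono[OF Z_depends]) auto

lemma B_nonneg: "0 \<le> B"
  using C_nonneg \<rho> by (simp add: B_def)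

text \<open>Blocks with i + m <= k are already determined and contribute nothing. At most m blocks
  with i <= k are still open, each contributing at most 2C. Blocks with i > k contribute 2C
  \<rho>^(i-k-1), a geometric series.\<close>

lemma D_bound:
  assumes k: "k < N" and x: "x \<in> space \<mu>"
  shows "\<bar>D k x\<bar> \<le> B"
proof -
  have 1: "\<bar>Q (Suc k) (Z i) x - Q k (Z i) x\<bar> \<le>
      2 * C * (of_bool (i \<in> {Suc k - m..<Suc k}) + of_bool (i \<in> {Suc k..n}) * \<rho> ^ (i - Suc k))"
    if i: "i \<in> {1..n}" for i
  proof (cases "i + m \<le> k")
    case True
    then show ?thesis
      using increment_eq_0[OF k x i] C_nonneg \<rho> by simp
  next
    case False
    have "\<bar>Q (Suc k) (Z i) x - Q k (Z i) x\<bar> \<le> \<rho> ^ (i - Suc k) * (2 * C)"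
      by (rule Q_increment[OF k Z_bounded[OF i] Z_depends_from[OF i] _ _ x]) (use i N in auto)
    then show ?thesis
      using False i by (auto simp: mult.commute not_le)
  qed
  have "\<bar>D k x\<bar> \<le> (\<Sum>i\<in>{1..n}. \<bar>Q (Suc k) (Z i) x - Q k (Z i) x\<bar>)"
    unfolding D_eq_sum[OF k x] by (rule sum_abs)
  also have "\<dots> \<le> (\<Sum>i\<in>{1..n}. 2 * C * (of_bool (i \<in> {Suc k - m..<Suc k}) + of_bool (i \<in> {Suc k..n}) * \<rho> ^ (i - Suc k)))"
    by (rule sum_mono[OF 1])
  also have "\<dots> = 2 * C * ((\<Sum>i\<in>{1..n}. of_bool (i \<in> {Suc k - m..<Suc k})) +
      (\<Sum>i\<in>{1..n}. of_bool (i \<in> {Suc k..n}) * \<rho> ^ (i - Suc k)))"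
    by (simp only: sum_distrib_left[symmetric] sum.distrib)
  also have "\<dots> \<le> B"
    unfolding B_def
  proof (intro mult_left_mono add_mono)
    have "(\<Sum>i\<in>{1..n}. of_bool (i \<in> {Suc k - m..<Suc k}) :: real) = real (card ({1..n} \<inter> {Suc k - m..<Suc k}))"
      by (subst sum_of_bool_eq) (simp_all only: Int_def mem_Collect_eq finite_atLeastAtMost)
    also have "\<dots> \<le> real (card {Suc k - m..<Suc k})"
      by (intro of_nat_mono card_mono) auto
    also have "\<dots> \<le> real m" by simp
    finally show "(\<Sum>i\<in>{1..n}. of_bool (i \<in> {Suc k - m..<Suc k})) \<le> real m" .
    have "(\<Sum>i\<in>{1..n}. of_bool (i \<in> {Suc k..n}) * \<rho> ^ (i - Suc k)) = (\<Sum>i\<in>{Suc k..n}. \<rho> ^ (i - Suc k))"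
      by (rule sum.mono_neutral_cong_right) auto
    also have "\<dots> = (\<Sum>i\<in>(\<lambda>i. i - Suc k) ` {Suc k..n}. \<rho> ^ i)"
      by (subst sum.reindex) (auto intro!: inj_onI)
    also have "\<dots> \<le> 1 / (1 - \<rho>)"
      using sum_le_suminf[of "\<lambda>i. \<rho> ^ i" "(\<lambda>i. i - Suc k) ` {Suc k..n}"] \<rho>
        suminf_geometric[of \<rho>] summable_geometric[of \<rho>] by simp
    finally show "(\<Sum>i\<in>{1..n}. of_bool (i \<in> {Suc k..n}) * \<rho> ^ (i - Suc k)) \<le> 1 / (1 - \<rho>)" .
  qed (use C_nonneg in auto)
  finally show ?thesis .
qed

lemma D_measurable: "D k \<in> borel_measurable \<mu>"
  unfolding D_def[abs_def]
  by (intro borel_measurable_diff Q_measurable[OF S_bounded])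

lemma D_beyond: "N \<le> k \<Longrightarrow> D k x = 0"
  by (simp add: D_def Q_beyond)

lemma D_bounded: "bounded_measurable \<mu> B (D k)"
  using D_measurable D_bound D_beyond B_nonneg unfolding bounded_measurable_def
  by (metis abs_zero not_le)

lemma D_square_bounded: "bounded_measurable \<mu> (B\<^sup>2) (\<lambda>x. (D k x)\<^sup>2)"
  using bounded_measurable_mult[OF D_bounded D_bounded] by (simp add: power2_eq_square)

text \<open>Only blocks with i > k - m survive in D_k, and their conditional expectations look back
  no further than min(i, k). This makes \<open>Q_oscillation\<close> applicable to D_k^2 with l = k
  - m.\<close>

lemma D_depends:
  assumes k: "k < N"
  shows "depends_on \<mu> {k - m..} (D k)"
proof (rule depends_onI)
  fix x y assume x: "x \<in> space \<mu>" and y: "y \<in> space \<mu>"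
    and eq: "\<And>i. i \<in> {k - m..} \<Longrightarrow> x i = y i"
  have "Q (Suc k) (Z i) x - Q k (Z i) x = Q (Suc k) (Z i) y - Q k (Z i) y" if i: "i \<in> {1..n}" for i
  proof (cases "i + m \<le> k")
    case True
    then show ?thesis
      using increment_eq_0[OF k _ i] x y by simp
  next
    case False
    have "Q (Suc k) (Z i) x = Q (Suc k) (Z i) y"
      by (rule depends_onD[OF Q_depends[OF _ Z_depends_from[OF i]] x y]) (use k False in \<open>auto intro!: eq\<close>)
    moreover have "Q k (Z i) x = Q k (Z i) y"
      by (rule depends_onD[OF Q_depends[OF _ Z_depends_from[OF i]] x y]) (use k False in \<open>auto intro!: eq\<close>)
    ultimately show ?thesis by simp
  qed
  then show "D k x = D k y"
    unfolding D_eq_sum[OF k x] D_eq_sum[OF k y] by (rule sum.cong[OF refl])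
qed

lemma r: "0 < r" "r < 1" "\<rho> \<le> r"
  using \<rho> by (auto simp: r_def)

text \<open>\<open>H j k\<close> is the deviation of a conditional expectation from its own mean,
  hence at most its oscillation. The block length costs m contraction steps, which are absorbed into
  the constant 1/r^m. Since k < n + m, the index k - m is at most n, so the contracting steps below
  n suffice.\<close>

lemma H_bound:
  assumes jk: "j \<le> k" and k: "k < N" and x: "x \<in> space \<mu>"
  shows "\<bar>H j k x\<bar> \<le> 2 * B\<^sup>2 / r ^ m * r ^ (k - j)"
proof -
  have "\<bar>H j k x\<bar> \<le> \<rho> ^ (k - m - j) * (2 * B\<^sup>2)"
  proof -
    have "\<bar>Q j (\<lambda>y. (D k y)\<^sup>2) x - expectation (Q j (\<lambda>y. (D k y)\<^sup>2))\<bar> \<le> \<rho> ^ (k - m - j) * (2 * B\<^sup>2)"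
    proof (rule deviation_le_oscillation)
      show "integrable \<mu> (Q j (\<lambda>y. (D k y)\<^sup>2))"
        by (rule integrable_bounded_measurable[OF Q_bounded_measurable[OF D_square_bounded]])
      fix y assume y: "y \<in> space \<mu>"
      show "\<bar>Q j (\<lambda>y. (D k y)\<^sup>2) x - Q j (\<lambda>y. (D k y)\<^sup>2) y\<bar> \<le> \<rho> ^ (k - m - j) * (2 * B\<^sup>2)"
        by (rule Q_oscillation[OF D_square_bounded depends_on_comp[OF D_depends[OF k]] _ _ x y])
          (use k N in auto)
    qed
    then show ?thesis
      using Q_expectation[OF _ D_square_bounded, of j k] jk k by (simp add: H_def)
  qed
  also have "\<dots> \<le> r ^ (k - m - j) * (2 * B\<^sup>2)"
    using r \<rho> by (intro mult_right_mono power_mono) auto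
  also have "r ^ (k - m - j) = r ^ (k - m - j + m) / r ^ m"
    using r by (simp add: power_add)
  \<comment> \<open>The inequality k - m - j + m >= k - j also holds when the subtraction
    truncates.\<close>
  also have "r ^ (k - m - j + m) / r ^ m * (2 * B\<^sup>2) \<le> r ^ (k - j) / r ^ m * (2 * B\<^sup>2)"
    using r by (intro mult_right_mono divide_right_mono power_decreasing) auto
  finally show ?thesis by (simp add: mult_ac)
qed

lemma partial_sum: "(\<Sum>i<k. D i x) = Q k S x - Q 0 S x"
  unfolding D_def by (rule sum_lessThan_telescope)

lemma partial_sum_depends:
  assumes "k \<le> N"
  shows "depends_on \<mu> {..k} (\<lambda>x. \<Sum>i<k. D i x)"
  unfolding partial_sum
  by (intro depends_on_diff Q_adapted assms depends_on_mono[OF Q_adapted[of 0]]) auto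

lemma partial_sum_bounded: "bounded_measurable \<mu> (real k * B) (\<lambda>x. \<Sum>i<k. D i x)"
  using bounded_measurable_sum[of "{..<k}" \<mu> B D] D_bounded by simp

text \<open>\<open>Q 0 S\<close> depends on coordinate 0 only, and that coordinate is
  \<open>undefined\<close> on every path, so \<open>Q 0 S\<close> is constant and equals its
  mean.\<close>

lemma Q_0: 
  assumes "x \<in> space \<mu>"
  shows "Q 0 S x = expectation S"
proof -
  have "Q 0 S x = Q 0 S y" if "y \<in> space \<mu>" for y
    by (rule depends_onD[OF Q_adapted assms that]) (use assms that in \<open>auto simp: coord_outside\<close>)
  then have "expectation (Q 0 S) = expectation (\<lambda>_. Q 0 S x)"
    by (intro Bochner_Integration.integral_cong) auto
  then show ?thesis
    using Q_expectation[OF _ S_bounded, of 0] by (simp add: prob_space)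
qed

lemma total_sum:
  assumes "x \<in> space \<mu>"
  shows "(\<Sum>i<N. D i x) = S x - expectation S"
  using Q_0[OF assms] by (simp add: partial_sum Q_beyond)

lemma D_orthogonal:
  assumes k: "k < N" and Y: "bounded_measurable \<mu> b Y" "depends_on \<mu> {..k} Y"
  shows "expectation (\<lambda>x. Y x * D k x) = 0"
proof -
  have i: "integrable \<mu> (\<lambda>x. Y x * Q j S x)" for j
    by (rule integrable_bounded_measurable[OF bounded_measurable_mult[OF Y(1) Q_bounded_measurable[OF S_bounded]]])
  have "expectation (\<lambda>x. Y x * D k x) =
      expectation (\<lambda>x. Y x * Q (Suc k) S x) - expectation (\<lambda>x. Y x * Q k S x)"
    unfolding D_def right_diff_distrib by (rule Bochner_Integration.integral_diff[OF i i])
  then show ?thesis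
    using Q_expectation_mult[OF _ Y(1) _ S_bounded, of "Suc k"]
      Q_expectation_mult[OF _ Y(1) _ S_bounded, of k] k Y(2) depends_on_mono[OF Y(2), of "{..Suc k}"]
    by auto
qed

text \<open>Pythagoras for orthogonal martingale differences. It identifies the normalisation of S
  with the sum of the \<sigma>_k required by the martingale bound.\<close>

lemma variance_eq:
  "variance S = (\<Sum>k<N. expectation (\<lambda>x. (D k x)\<^sup>2))"
proof -
  have "expectation (\<lambda>x. (\<Sum>i<k. D i x)\<^sup>2) = (\<Sum>i<k. expectation (\<lambda>x. (D i x)\<^sup>2))" if "k \<le> N" for k
    using that
  proof (induction k)
    case (Suc k)
    let ?P = "\<lambda>x. \<Sum>i<k. D i x"
    have i: "integrable \<mu> (\<lambda>x. ?P x * ?P x)" "integrable \<mu> (\<lambda>x. ?P x * D k x)" "integrable \<mu> (\<lambda>x. (D k x)\<^sup>2)"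
      by (rule integrable_bounded_measurable[OF bounded_measurable_mult[OF partial_sum_bounded partial_sum_bounded]]
          integrable_bounded_measurable[OF bounded_measurable_mult[OF partial_sum_bounded D_bounded]]
          integrable_bounded_measurable[OF D_square_bounded])+
    have "expectation (\<lambda>x. (\<Sum>i<Suc k. D i x)\<^sup>2) =
        expectation (\<lambda>x. ?P x * ?P x + 2 * (?P x * D k x) + (D k x)\<^sup>2)"
      by (simp add: power2_eq_square algebra_simps)
    also have "\<dots> = expectation (\<lambda>x. ?P x * ?P x) + 2 * expectation (\<lambda>x. ?P x * D k x) + expectation (\<lambda>x. (D k x)\<^sup>2)"
      using i by simp
    also have "expectation (\<lambda>x. ?P x * D k x) = 0"
      using Suc by (intro D_orthogonal[OF _ partial_sum_bounded partial_sum_depends]) auto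
    finally show ?case
      using Suc by (simp add: power2_eq_square)
  qed simp
  from this[OF order_refl] show ?thesis
    by (simp add: total_sum cong: Bochner_Integration.integral_cong)
qed

lemma bounded_range_comp:
  assumes g: "g \<in> borel_measurable borel" "bounded (range g)" and F: "F \<in> borel_measurable \<mu>"
  obtains b where "bounded_measurable \<mu> b (\<lambda>x. g (F x) :: real)"
proof -
  obtain b where "\<And>y. \<bar>g y\<bar> \<le> b"
    using g(2) unfolding bounded_iff by auto
  then have "bounded_measurable \<mu> b (\<lambda>x. g (F x))"
    using measurable_compose[OF F g(1)] by (simp add: bounded_measurable_def)
  then show ?thesis by (rule that)
qed

text \<open>The mixing rate of \<open>H_bound\<close> is r, and the locale asks for a squared rate,
  hence sqrt r.\<close>

lemma D_mixing_martingale: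
  "mixing_martingale \<mu> N D H B (2 * B\<^sup>2 / r ^ m) (sqrt r)"
proof unfold_locales
  show "D k \<in> borel_measurable \<mu>" for k by (rule D_measurable)
  show "\<bar>D k x\<bar> \<le> B" if "k < N" "x \<in> space \<mu>" for k x by (rule D_bound[OF that])
  show "H j k \<in> borel_measurable \<mu>" for j k
    unfolding H_def[abs_def]
    by (intro borel_measurable_diff Q_measurable[OF D_square_bounded] borel_measurable_const)
  show "\<bar>H j k x\<bar> \<le> 2 * B\<^sup>2 / r ^ m * (sqrt r ^ (k - j))\<^sup>2" if "j \<le> k" "k < N" "x \<in> space \<mu>" for j k x
  proof -
    have "(sqrt r ^ (k - j))\<^sup>2 = r ^ (k - j)"
      using r by (metis power2_eq_square power_mult_distrib real_sqrt_mult_self abs_of_pos)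
    then show ?thesis using H_bound[OF that] by simp
  qed
  show "0 \<le> B" by (rule B_nonneg)
  show "0 \<le> 2 * B\<^sup>2 / r ^ m" "0 < sqrt r" "sqrt r < 1" using r by auto
  show "expectation (\<lambda>x. g (\<Sum>i<k. D i x) * D k x) = 0"
    if k: "k < N" and g: "g \<in> borel_measurable borel" "bounded (range g)" for k g
  proof -
    obtain b where b: "bounded_measurable \<mu> b (\<lambda>x. g (\<Sum>i<k. D i x))"
      by (rule bounded_range_comp[OF g bounded_measurable_measurable[OF partial_sum_bounded]])
    show ?thesis
      by (rule D_orthogonal[OF k b depends_on_comp[OF partial_sum_depends]]) (use k in auto)
  qed
  show "expectation (\<lambda>x. \<bar>H j k x\<bar>) \<le> 2 * expectation (\<lambda>x. (D k x)\<^sup>2)" if jk: "j \<le> k" "k < N" for j k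
  proof -
    define s where "s = expectation (\<lambda>x. (D k x)\<^sup>2)"
    have s: "0 \<le> s" by (simp add: s_def)
    have i: "integrable \<mu> (Q j (\<lambda>y. (D k y)\<^sup>2))"
      by (rule integrable_bounded_measurable[OF Q_bounded_measurable[OF D_square_bounded]])
    \<comment> \<open>The difference of two nonnegative quantities is dominated by their sum, and
      both have mean s; this is the factor 2.\<close>
    have "expectation (\<lambda>x. \<bar>H j k x\<bar>) \<le> expectation (\<lambda>x. Q j (\<lambda>y. (D k y)\<^sup>2) x + s)"
    proof (rule integral_mono)
      fix x assume x: "x \<in> space \<mu>"
      have "0 \<le> Q j (\<lambda>y. (D k y)\<^sup>2) x"
        using jk x by (intro Q_nonneg) auto
      then show "\<bar>H j k x\<bar> \<le> Q j (\<lambda>y. (D k y)\<^sup>2) x + s"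
        using s by (simp add: H_def s_def[symmetric] abs_le_iff)
    qed (use i in \<open>auto simp: H_def\<close>)
    also have "\<dots> = 2 * s"
      using i Q_expectation[OF _ D_square_bounded, of j k] jk by (simp add: prob_space s_def)
    finally show ?thesis by (simp add: s_def)
  qed
  show "expectation (\<lambda>x. g (\<Sum>l<i. D l x) * ((D k x)\<^sup>2 - expectation (\<lambda>y. (D k y)\<^sup>2))) =
      expectation (\<lambda>x. g (\<Sum>l<i. D l x) * H j k x)"
    if ijk: "i \<le> j" "j \<le> k" "k < N" and g: "g \<in> borel_measurable borel" "bounded (range g)" for i j k g
  proof -
    define s where "s = expectation (\<lambda>x. (D k x)\<^sup>2)"
    define Y where "Y x = g (\<Sum>l<i. D l x)" for x
    obtain b where b: "bounded_measurable \<mu> b Y"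
      unfolding Y_def by (rule bounded_range_comp[OF g bounded_measurable_measurable[OF partial_sum_bounded]])
    have dep: "depends_on \<mu> {..j} Y"
      unfolding Y_def
      by (rule depends_on_mono[OF depends_on_comp[OF partial_sum_depends]]) (use ijk in auto)
    have i: "integrable \<mu> Y" "integrable \<mu> (\<lambda>x. Y x * (D k x)\<^sup>2)"
      "integrable \<mu> (\<lambda>x. Y x * Q j (\<lambda>y. (D k y)\<^sup>2) x)"
      by (rule integrable_bounded_measurable[OF b]
          integrable_bounded_measurable[OF bounded_measurable_mult[OF b D_square_bounded]]
          integrable_bounded_measurable[OF bounded_measurable_mult[OF b Q_bounded_measurable[OF D_square_bounded]]])+
    have "expectation (\<lambda>x. Y x * ((D k x)\<^sup>2 - s)) = expectation (\<lambda>x. Y x * (D k x)\<^sup>2) - expectation (\<lambda>x. Y x * s)"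
      unfolding right_diff_distrib by (rule Bochner_Integration.integral_diff) (use i in auto)
    also have "expectation (\<lambda>x. Y x * (D k x)\<^sup>2) = expectation (\<lambda>x. Y x * Q j (\<lambda>y. (D k y)\<^sup>2) x)"
      by (rule Q_expectation_mult[OF _ b dep D_square_bounded, symmetric]) (use ijk in auto)
    also have "\<dots> - expectation (\<lambda>x. Y x * s) = expectation (\<lambda>x. Y x * H j k x)"
      unfolding H_def s_def[symmetric] right_diff_distrib
      by (rule Bochner_Integration.integral_diff[symmetric]) (use i in auto)
    finally show ?thesis by (simp add: Y_def s_def)
  qed
qed

lemma char_bound:
  assumes "variance S > 0"
  defines "s \<equiv> sqrt (variance S)"
  shows "cmod (expectation (\<lambda>x. iexp (t * ((S x - expectation S) / s))) - complex_of_real (exp (- (t\<^sup>2 / 2))))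
    \<le> clt_error \<rho> m C t s"
proof -
  interpret mixing_martingale \<mu> N D H B "2 * B\<^sup>2 / r ^ m" "sqrt r"
    by (rule D_mixing_martingale)
  have s: "s > 0" "s\<^sup>2 = (\<Sum>k<N. \<sigma> k)"
    using assms(1) variance_eq by (simp_all add: s_def \<sigma>_def)
  have "expectation (\<lambda>x. iexp (t / s * psum N x)) = expectation (\<lambda>x. iexp (t * ((S x - expectation S) / s)))"
    by (rule Bochner_Integration.integral_cong) (simp_all add: psum_def total_sum)
  then show ?thesis
    using char_bound[OF s, of t] by (simp add: clt_error_def Let_def B_def r_def)
qed

end

section \<open>Markov chains as path measures\<close>

lemma measurable_path:
  assumes "\<And>i. i \<in> I \<Longrightarrow> X i \<in> M \<rightarrow>\<^sub>M E"
  shows "(\<lambda>\<omega>. \<lambda>j\<in>I. X j \<omega>) \<in> M \<rightarrow>\<^sub>M (\<Pi>\<^sub>M j\<in>I. E)"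
  by (rule measurable_restrict) (rule assms)

lemma measurable_at_coordinate:
  assumes "g \<in> E \<rightarrow>\<^sub>M L" "k \<in> I"
  shows "(\<lambda>x. g (x k)) \<in> (\<Pi>\<^sub>M j\<in>I. E) \<rightarrow>\<^sub>M L"
  by (rule measurable_compose[OF _ assms(1)]) (rule measurable_component_singleton[OF assms(2)])

lemma subalgebra_past_algebra:
  assumes "\<And>i. i \<in> {1..k} \<Longrightarrow> X i \<in> M \<rightarrow>\<^sub>M E"
  shows "subalgebra M (past_algebra M E X k)"
  using measurable_sets[OF measurable_path[OF assms, of "{1..k}"]]
    measurable_space[OF measurable_path[OF assms, of "{1..k}"]]
  by (auto simp: subalgebra_def past_algebra_def sets_vimage_algebra2)

text \<open>The hypothesis concerns one set B at a time, with an exceptional null set for each.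
  Integrated over events of the past it fixes the joint law of past and next state on rectangles,
  hence entirely, and the identity follows for every bounded H.\<close>

lemma markov_step:
  fixes H :: "(nat \<Rightarrow> 'a) \<times> 'a \<Rightarrow> real"
  assumes M: "prob_space M"
    and X: "\<And>i. i \<in> {1..Suc k} \<Longrightarrow> X i \<in> M \<rightarrow>\<^sub>M E"
    and k: "1 \<le> k" and K: "K \<in> E \<rightarrow>\<^sub>M prob_algebra E"
    and markov: "\<And>B. B \<in> sets E \<Longrightarrow> AE \<omega> in M.
        real_cond_exp M (past_algebra M E X k) (\<lambda>\<omega>. indicator B (X (Suc k) \<omega>)) \<omega> = measure (K (X k \<omega>)) B"
    and H: "H \<in> borel_measurable ((\<Pi>\<^sub>M j\<in>{1..k}. E) \<Otimes>\<^sub>M E)"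
      "\<And>p. p \<in> space ((\<Pi>\<^sub>M j\<in>{1..k}. E) \<Otimes>\<^sub>M E) \<Longrightarrow> \<bar>H p\<bar> \<le> b"
  shows "(\<integral>\<omega>. H (\<lambda>j\<in>{1..k}. X j \<omega>, X (Suc k) \<omega>) \<partial>M) =
    (\<integral>\<omega>. \<integral>y. H (\<lambda>j\<in>{1..k}. X j \<omega>, y) \<partial>K (X k \<omega>) \<partial>M)"
proof -
  interpret prob_space M by fact
  let ?P = "\<Pi>\<^sub>M j\<in>{1..k}. E"
  define \<xi> where "\<xi> \<omega> = (\<lambda>j\<in>{1..k}. X j \<omega>)" for \<omega>
  have \<xi> [measurable]: "\<xi> \<in> M \<rightarrow>\<^sub>M ?P"
    unfolding \<xi>_def by (rule measurable_path) (use X in auto)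
  have [measurable]: "X (Suc k) \<in> M \<rightarrow>\<^sub>M E" "X k \<in> M \<rightarrow>\<^sub>M E"
    using X k by auto
  have \<xi>k: "\<xi> \<omega> k = X k \<omega>" for \<omega> using k by (simp add: \<xi>_def)
  have Kk: "(\<lambda>x. K (x k)) \<in> ?P \<rightarrow>\<^sub>M subprob_algebra E"
    using k by (intro measurable_at_coordinate measurable_prob_algebraD[OF K]) auto
  have Kx: "prob_space (K y)" "sets (K y) = sets E" if "y \<in> space E" for y
    using measurable_space[OF K that] by (auto simp: space_prob_algebra)
  have xk: "x k \<in> space E" if "x \<in> space ?P" for x
    using that k by (auto simp: space_PiM)
  \<comment> \<open>The conditional joint law: the past is kept fixed at x and the next state is
    drawn from the kernel at its last coordinate.\<close>
  define L where "L x = distr (K (x k)) (?P \<Otimes>\<^sub>M E) (Pair x)" for x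
  have L: "L \<in> ?P \<rightarrow>\<^sub>M subprob_algebra (?P \<Otimes>\<^sub>M E)"
    unfolding L_def by (rule measurable_distr2[OF _ Kk]) simp
  have Pair: "Pair x \<in> K (x k) \<rightarrow>\<^sub>M ?P \<Otimes>\<^sub>M E" if "x \<in> space ?P" for x
    using measurable_Pair1'[OF that, of E] by (simp add: measurable_cong_sets[OF Kx(2)[OF xk[OF that]] refl])
  define \<mu> where "\<mu> = distr M ?P \<xi>"
  interpret \<mu>: prob_space \<mu> unfolding \<mu>_def by (rule prob_space_distr[OF \<xi>])
  have sets_\<mu> [measurable_cong]: "sets \<mu> = sets ?P" by (simp add: \<mu>_def)
  have L': "L \<in> \<mu> \<rightarrow>\<^sub>M subprob_algebra (?P \<Otimes>\<^sub>M E)"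
    using L by (simp add: measurable_cong_sets[OF sets_\<mu> refl])
  note One_nat_def [simp del]
  define \<eta> where "\<eta> = distr M (?P \<Otimes>\<^sub>M E) (\<lambda>\<omega>. (\<xi> \<omega>, X (Suc k) \<omega>))"
  have "\<eta> = \<mu> \<bind> L"
  \<comment> \<open>Rectangles are stable under intersection and the whole space is one of them, so
    agreement on rectangles suffices.\<close>
  proof (rule measure_eqI_generator_eq[OF Int_stable_pair_measure_generator[of ?P E]])
    show "{a \<times> b |a b. a \<in> sets ?P \<and> b \<in> sets E} \<subseteq> Pow (space (?P \<Otimes>\<^sub>M E))"
      using sets.space_closed[of ?P] sets.space_closed[of E] by (auto simp: space_pair_measure)
    show "sets \<eta> = sigma_sets (space (?P \<Otimes>\<^sub>M E)) {a \<times> b |a b. a \<in> sets ?P \<and> b \<in> sets E}"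
      by (simp add: \<eta>_def sets_pair_measure space_pair_measure)
    have "sets (\<mu> \<bind> L) = sets (?P \<Otimes>\<^sub>M E)"
      by (rule sets_bind[OF sets_kernel[OF L'] \<mu>.not_empty])
    then show "sets (\<mu> \<bind> L) = sigma_sets (space (?P \<Otimes>\<^sub>M E)) {a \<times> b |a b. a \<in> sets ?P \<and> b \<in> sets E}"
      by (simp add: sets_pair_measure space_pair_measure)
    show "range (\<lambda>_::nat. space (?P \<Otimes>\<^sub>M E)) \<subseteq> {a \<times> b |a b. a \<in> sets ?P \<and> b \<in> sets E}"
      by (auto simp: space_pair_measure)
    show "(\<Union>_::nat. space (?P \<Otimes>\<^sub>M E)) = space (?P \<Otimes>\<^sub>M E)" by simp
    show "emeasure \<eta> (space (?P \<Otimes>\<^sub>M E)) \<noteq> \<infinity>" for i :: nat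
      unfolding \<eta>_def by (subst emeasure_distr) auto
    fix R assume "R \<in> {a \<times> b |a b. a \<in> sets ?P \<and> b \<in> sets E}"
    then obtain A B where R: "R = A \<times> B" and A [measurable]: "A \<in> sets ?P" and B [measurable]: "B \<in> sets E"
      by blast
    have sub: "subalgebra M (past_algebra M E X k)"
      by (rule subalgebra_past_algebra) (use X in auto)
    interpret F: sigma_finite_subalgebra M "past_algebra M E X k"
      by (intro finite_measure_subalgebra_is_sigma_finite finite_measure_subalgebra.intro
          finite_measure_subalgebra_axioms.intro sub finite_measure_axioms)
    have FA: "(\<lambda>\<omega>. indicator A (\<xi> \<omega>) :: real) \<in> borel_measurable (past_algebra M E X k)"
    proof (rule measurable_compose[OF _ borel_measurable_indicator[OF A]])
      show "\<xi> \<in> past_algebra M E X k \<rightarrow>\<^sub>M ?P"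
        unfolding past_algebra_def \<xi>_def[symmetric]
        by (rule measurable_vimage_algebra1) (use measurable_space[OF \<xi>] in auto)
    qed
    have mK: "(\<lambda>\<omega>. measure (K (X k \<omega>)) B) \<in> borel_measurable M"
      by (rule measurable_compose[OF _ measurable_compose[OF K measurable_measure_prob_algebra[OF B]]]) simp
    have "emeasure \<eta> R = (\<integral>\<^sup>+p. indicator R p \<partial>\<eta>)"
      by (rule nn_integral_indicator[symmetric]) (simp add: \<eta>_def R)
    also have "\<dots> = (\<integral>\<^sup>+\<omega>. indicator R (\<xi> \<omega>, X (Suc k) \<omega>) \<partial>M)"
      unfolding \<eta>_def R by (rule nn_integral_distr) auto
    also have "\<dots> = (\<integral>\<^sup>+\<omega>. ennreal (indicator A (\<xi> \<omega>) * indicator B (X (Suc k) \<omega>)) \<partial>M)"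
      by (rule nn_integral_cong) (auto simp: R indicator_def)
    also have "\<dots> = ennreal (expectation (\<lambda>\<omega>. indicator A (\<xi> \<omega>) * indicator B (X (Suc k) \<omega>)))"
      by (rule nn_integral_eq_integral)
        (auto intro!: integrable_bounded[where B = 1] simp: indicator_def)
    \<comment> \<open>The event that the past lies in A belongs to the past algebra, so the other
      factor may be replaced by its conditional expectation.\<close>
    also have "expectation (\<lambda>\<omega>. indicator A (\<xi> \<omega>) * indicator B (X (Suc k) \<omega>)) =
        expectation (\<lambda>\<omega>. indicator A (\<xi> \<omega>) *
          real_cond_exp M (past_algebra M E X k) (\<lambda>\<omega>. indicator B (X (Suc k) \<omega>)) \<omega>)"
      by (rule F.real_cond_exp_intg(2)[symmetric, OF _ FA])
        (auto intro!: integrable_bounded[where B = 1] simp: indicator_def)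
    also have "\<dots> = expectation (\<lambda>\<omega>. indicator A (\<xi> \<omega>) * measure (K (X k \<omega>)) B)"
      by (rule integral_cong_AE) (use mK markov[OF B] in auto)
    also have "ennreal \<dots> = (\<integral>\<^sup>+\<omega>. ennreal (indicator A (\<xi> \<omega>) * measure (K (X k \<omega>)) B) \<partial>M)"
    proof (rule nn_integral_eq_integral[symmetric])
      show "integrable M (\<lambda>\<omega>. indicator A (\<xi> \<omega>) * measure (K (X k \<omega>)) B)"
      proof (rule integrable_bounded[where B = 1])
        fix \<omega> assume \<omega>: "\<omega> \<in> space M"
        interpret Kx: prob_space "K (X k \<omega>)"
          by (rule Kx(1)[OF measurable_space[OF X \<omega>]]) (use k in auto)
        show "norm (indicator A (\<xi> \<omega>) * measure (K (X k \<omega>)) B) \<le> 1"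
          by (simp add: indicator_def)
      qed (use mK in auto)
    qed auto
    also have "\<dots> = (\<integral>\<^sup>+\<omega>. emeasure (L (\<xi> \<omega>)) R \<partial>M)"
    proof (rule nn_integral_cong)
      fix \<omega> assume \<omega>: "\<omega> \<in> space M"
      then have x: "\<xi> \<omega> \<in> space ?P" by (rule measurable_space[OF \<xi>])
      interpret Kx: prob_space "K (X k \<omega>)"
        using Kx(1)[OF xk[OF x]] by (simp add: \<xi>k)
      have "emeasure (L (\<xi> \<omega>)) R = emeasure (K (X k \<omega>)) (Pair (\<xi> \<omega>) -` R \<inter> space (K (X k \<omega>)))"
        unfolding L_def using Pair[OF x] by (subst emeasure_distr) (auto simp: R \<xi>k)
      also have "Pair (\<xi> \<omega>) -` R \<inter> space (K (X k \<omega>)) = (if \<xi> \<omega> \<in> A then B else {})"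
        using sets.sets_into_space[OF B] sets_eq_imp_space_eq[OF Kx(2)[OF xk[OF x]]]
        by (auto simp: R \<xi>k)
      finally show "ennreal (indicator A (\<xi> \<omega>) * measure (K (X k \<omega>)) B) = emeasure (L (\<xi> \<omega>)) R"
        by (simp add: Kx.emeasure_eq_measure)
    qed
    also have "\<dots> = (\<integral>\<^sup>+x. emeasure (L x) R \<partial>\<mu>)"
      unfolding \<mu>_def using L
      by (subst nn_integral_distr) (auto simp: R intro: measurable_compose[OF L measurable_emeasure_subprob_algebra])
    also have "\<dots> = emeasure (\<mu> \<bind> L) R"
      by (rule emeasure_bind[OF \<mu>.not_empty L', symmetric]) (auto simp: R)
    finally show "emeasure \<eta> R = emeasure (\<mu> \<bind> L) R" .
  qed
  have "(\<integral>\<omega>. H (\<xi> \<omega>, X (Suc k) \<omega>) \<partial>M) = (\<integral>p. H p \<partial>\<eta>)"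
    unfolding \<eta>_def by (subst integral_distr) (use H(1) in auto)
  also have "\<dots> = (\<integral>x. \<integral>p. H p \<partial>L x \<partial>\<mu>)"
    unfolding \<open>\<eta> = \<mu> \<bind> L\<close>
  proof (rule integral_bind[OF H L', where B' = 1])
    show "finite_measure \<mu>" by unfold_locales
    show "AE x in \<mu>. emeasure (L x) (space (L x)) \<le> ennreal 1"
      using subprob_space.emeasure_space_le_1[OF subprob_space_kernel[OF L']] by auto
  qed
  also have "\<dots> = (\<integral>x. \<integral>y. H (x, y) \<partial>K (x k) \<partial>\<mu>)"
    unfolding L_def using H(1) sets_eq_imp_space_eq[OF sets_\<mu>] Pair
    by (intro Bochner_Integration.integral_cong refl integral_distr) auto
  also have "\<dots> = (\<integral>\<omega>. \<integral>y. H (\<xi> \<omega>, y) \<partial>K (\<xi> \<omega> k) \<partial>M)"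
    unfolding \<mu>_def
    by (rule integral_distr[OF \<xi> integral_measurable_subprob_algebra2[OF _ Kk]]) (use H(1) in simp)
  finally show ?thesis unfolding \<xi>k unfolding \<xi>_def .
qed

text \<open>The initial law counts as a step from time \<open>0\<close>, so that paths have no special first
  step: coordinate \<open>0\<close> lies outside \<open>{1..N}\<close>, hence is \<open>undefined\<close> on every path.\<close>

definition path_kernel :: "'a measure \<Rightarrow> (nat \<Rightarrow> 'a \<Rightarrow> 'a measure) \<Rightarrow> nat \<Rightarrow> (nat \<Rightarrow> 'a) \<Rightarrow> 'a measure" where
  "path_kernel \<nu> K k x = (if k = 0 then \<nu> else K k (x k))"

text \<open>The substance is the integrated Markov property on path space. At k = 0 it says that X 1
  has the initial law, for k >= 1 it is \<open>markov_step\<close>.\<close>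

lemma markov_chain_path_chain:
  assumes chain: "markov_chain M E N K X"
    and N: "1 \<le> N"
    and \<rho>: "0 \<le> \<rho>" "\<rho> < 1"
    and contraction: "\<And>k y z A. 1 \<le> k \<Longrightarrow> k < n \<Longrightarrow> k < N \<Longrightarrow> y \<in> space E \<Longrightarrow> z \<in> space E \<Longrightarrow> A \<in> sets E \<Longrightarrow>
      \<bar>measure (K k y) A - measure (K k z) A\<bar> \<le> \<rho>"
  shows "path_chain (distr M (\<Pi>\<^sub>M j\<in>{1..N}. E) (\<lambda>\<omega>. \<lambda>j\<in>{1..N}. X j \<omega>)) E N n
    (path_kernel (distr M E (X 1)) K) \<rho>"
proof -
  from chain have M: "prob_space M"
    and X: "\<And>i. i \<in> {1..N} \<Longrightarrow> X i \<in> M \<rightarrow>\<^sub>M E"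
    and K: "\<And>k. k \<in> {1..<N} \<Longrightarrow> K k \<in> E \<rightarrow>\<^sub>M prob_algebra E"
    and markov: "\<And>k B. k \<in> {1..<N} \<Longrightarrow> B \<in> sets E \<Longrightarrow> AE \<omega> in M.
        real_cond_exp M (past_algebra M E X k) (\<lambda>\<omega>. indicator B (X (Suc k) \<omega>)) \<omega> = measure (K k (X k \<omega>)) B"
    unfolding markov_chain_def by auto
  interpret prob_space M by fact
  let ?P = "\<Pi>\<^sub>M j\<in>{1..N}. E"
  define \<Xi> where "\<Xi> \<omega> = (\<lambda>j\<in>{1..N}. X j \<omega>)" for \<omega>
  have \<Xi>: "\<Xi> \<in> M \<rightarrow>\<^sub>M ?P"
    unfolding \<Xi>_def by (rule measurable_path) (rule X)
  define \<mu> where "\<mu> = distr M ?P \<Xi>"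
  interpret \<mu>: prob_space \<mu> unfolding \<mu>_def by (rule prob_space_distr[OF \<Xi>])
  have sets_\<mu>: "sets \<mu> = sets ?P" by (simp add: \<mu>_def)
  have space_\<mu>: "space \<mu> = {1..N} \<rightarrow>\<^sub>E space E"
    using sets_eq_imp_space_eq[OF sets_\<mu>] by (simp add: space_PiM)
  have \<Xi>_space: "\<Xi> \<omega> \<in> space \<mu>" if "\<omega> \<in> space M" for \<omega>
    using measurable_space[OF \<Xi> that] by (simp add: \<mu>_def)
  define \<nu> where "\<nu> = distr M E (X 1)"
  interpret \<nu>: prob_space \<nu> unfolding \<nu>_def by (rule prob_space_distr) (use X N in auto)
  have upd: "x(Suc k := y) \<in> space \<mu>" if "k < N" "x \<in> space \<mu>" "y \<in> space E" for x y k
    using that unfolding space_\<mu> by (auto simp: PiE_iff extensional_def)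
  \<comment> \<open>A reference path, used to fill the coordinates to which the test function is
    insensitive.\<close>
  obtain z where z: "z \<in> space \<mu>" using \<mu>.not_empty by auto
  have zE: "z i \<in> space E" if "i \<in> {1..N}" for i
    using z that unfolding space_\<mu> by auto
  have outside: "x 0 = undefined" if "x \<in> space \<mu>" for x
    using that unfolding space_\<mu> by (auto simp: PiE_iff extensional_def)
  have step: "\<mu>.expectation (\<lambda>x. \<integral>y. F (x(Suc k := y)) \<partial>path_kernel \<nu> K k x) = \<mu>.expectation F"
    if k: "k < N" and F: "bounded_measurable \<mu> b F" and dep: "depends_on \<mu> {..Suc k} F" for k b F
  proof (cases "k = 0")
    case True
    have Fm: "F \<in> borel_measurable ?P"
      using F by (simp add: bounded_measurable_def measurable_cong_sets[OF sets_\<mu> refl])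
    have zm: "(\<lambda>y. z(Suc 0 := y)) \<in> E \<rightarrow>\<^sub>M ?P"
    proof -
      have "(\<lambda>y. \<lambda>i\<in>{1..N}. if i = Suc 0 then y else z i) \<in> E \<rightarrow>\<^sub>M ?P"
        by (intro measurable_restrict) (use zE in auto)
      moreover have "(\<lambda>i\<in>{1..N}. if i = Suc 0 then y else z i) = z(Suc 0 := y)" for y
        using z N unfolding space_\<mu> by (auto simp: PiE_iff extensional_def fun_eq_iff)
      ultimately show ?thesis by simp
    qed
    have "F (x(Suc 0 := y)) = F (z(Suc 0 := y))" if "x \<in> space \<mu>" "y \<in> space E" for x y
      by (rule depends_onD[OF dep])
        (use that z upd[of 0] N True outside[OF z] outside[OF that(1)] in \<open>auto simp: le_Suc_eq\<close>)
    then have "\<mu>.expectation (\<lambda>x. \<integral>y. F (x(Suc k := y)) \<partial>path_kernel \<nu> K k x) =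
        \<mu>.expectation (\<lambda>x. \<integral>y. F (z(Suc 0 := y)) \<partial>\<nu>)"
      using True by (intro Bochner_Integration.integral_cong refl)
        (auto simp: path_kernel_def \<nu>_def intro!: Bochner_Integration.integral_cong)
    also have "\<dots> = (\<integral>y. F (z(Suc 0 := y)) \<partial>\<nu>)"
      by (simp add: \<mu>.prob_space)
    also have "\<dots> = expectation (\<lambda>\<omega>. F (z(Suc 0 := X 1 \<omega>)))"
      unfolding \<nu>_def using X N
      by (intro integral_distr measurable_compose[OF zm Fm]) auto
    also have "\<dots> = expectation (\<lambda>\<omega>. F (\<Xi> \<omega>))"
    proof (rule Bochner_Integration.integral_cong[OF refl])
      fix \<omega> assume \<omega>: "\<omega> \<in> space M"
      have "X 1 \<omega> \<in> space E" using measurable_space[OF X \<omega>] N by auto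
      then show "F (z(Suc 0 := X 1 \<omega>)) = F (\<Xi> \<omega>)"
        by (intro depends_onD[OF dep])
          (use z upd[of 0] N True outside[OF z] \<Xi>_space[OF \<omega>] in \<open>auto simp: le_Suc_eq \<Xi>_def\<close>)
    qed
    also have "\<dots> = \<mu>.expectation F"
      unfolding \<mu>_def by (rule integral_distr[OF \<Xi> Fm, symmetric])
    finally show ?thesis .
  next
    case False
    have Fm: "F \<in> borel_measurable ?P"
      using F by (simp add: bounded_measurable_def measurable_cong_sets[OF sets_\<mu> refl])
    let ?Pk = "\<Pi>\<^sub>M j\<in>{1..k}. E"
    \<comment> \<open>Completes a pair of past and next state to a full path with entries of z after
      time k+1, so that F becomes a function on the space used by
      \<open>markov_step\<close>.\<close>
    define e where "e p = (\<lambda>i\<in>{1..N}. if i \<le> k then fst p i else if i = Suc k then snd p else z i)"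
      for p :: "(nat \<Rightarrow> 'b) \<times> 'b"
    have e: "e \<in> ?Pk \<Otimes>\<^sub>M E \<rightarrow>\<^sub>M ?P"
      unfolding e_def[abs_def]
    proof (rule measurable_restrict)
      fix i assume i: "i \<in> {1..N}"
      have "(\<lambda>p. fst p i) \<in> ?Pk \<Otimes>\<^sub>M E \<rightarrow>\<^sub>M E" if "i \<le> k"
        by (rule measurable_compose[OF measurable_fst measurable_component_singleton]) (use i that in auto)
      then show "(\<lambda>p. if i \<le> k then fst p i else if i = Suc k then snd p else z i) \<in> ?Pk \<Otimes>\<^sub>M E \<rightarrow>\<^sub>M E"
        using zE[OF i] by (cases "i \<le> k"; cases "i = Suc k") auto
    qed
    have es: "e p \<in> space \<mu>" if "p \<in> space (?Pk \<Otimes>\<^sub>M E)" for p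
      using measurable_space[OF e that] sets_eq_imp_space_eq[OF sets_\<mu>] by simp
    have pair: "(\<lambda>j\<in>{1..k}. X j \<omega>, y) \<in> space (?Pk \<Otimes>\<^sub>M E)" if "\<omega> \<in> space M" "y \<in> space E" for \<omega> y
      using that measurable_space[OF X that(1)] k by (auto simp: space_pair_measure space_PiM)
    have eq: "F (e (\<lambda>j\<in>{1..k}. X j \<omega>, y)) = F ((\<Xi> \<omega>)(Suc k := y))" if "\<omega> \<in> space M" "y \<in> space E" for \<omega> y
      by (rule depends_onD[OF dep es[OF pair[OF that]] upd[OF k \<Xi>_space[OF that(1)] that(2)]])
        (use k in \<open>auto simp: e_def \<Xi>_def le_Suc_eq\<close>)
    have "\<mu>.expectation F = expectation (\<lambda>\<omega>. F (\<Xi> \<omega>))"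
      unfolding \<mu>_def by (rule integral_distr[OF \<Xi> Fm])
    also have "\<dots> = expectation (\<lambda>\<omega>. F (e (\<lambda>j\<in>{1..k}. X j \<omega>, X (Suc k) \<omega>)))"
    proof (rule Bochner_Integration.integral_cong[OF refl])
      fix \<omega> assume \<omega>: "\<omega> \<in> space M"
      have "(\<Xi> \<omega>)(Suc k := X (Suc k) \<omega>) = \<Xi> \<omega>"
        using k by (auto simp: \<Xi>_def)
      then show "F (\<Xi> \<omega>) = F (e (\<lambda>j\<in>{1..k}. X j \<omega>, X (Suc k) \<omega>))"
        using eq[OF \<omega>, of "X (Suc k) \<omega>"] measurable_space[OF X \<omega>, of "Suc k"] k by simp
    qed
    also have "\<dots> = expectation (\<lambda>\<omega>. \<integral>y. F (e (\<lambda>j\<in>{1..k}. X j \<omega>, y)) \<partial>K k (X k \<omega>))"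
    proof (rule markov_step[OF M, where H = "\<lambda>p. F (e p)" and b = b])
      show "\<bar>F (e p)\<bar> \<le> b" if "p \<in> space (?Pk \<Otimes>\<^sub>M E)" for p
        by (rule bounded_measurable_bound[OF F es[OF that]])
    qed (use False k X K markov measurable_compose[OF e Fm] in auto)
    also have "\<dots> = expectation (\<lambda>\<omega>. \<integral>y. F ((\<Xi> \<omega>)(Suc k := y)) \<partial>path_kernel \<nu> K k (\<Xi> \<omega>))"
    proof (rule Bochner_Integration.integral_cong[OF refl])
      fix \<omega> assume \<omega>: "\<omega> \<in> space M"
      have Xk: "X k \<omega> \<in> space E" using measurable_space[OF X \<omega>] k False by auto
      have "space (K k (X k \<omega>)) = space E"
        using measurable_space[OF K[of k] Xk] k False
        by (intro sets_eq_imp_space_eq) (simp add: space_prob_algebra)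
      moreover have "path_kernel \<nu> K k (\<Xi> \<omega>) = K k (X k \<omega>)"
        using k False by (simp add: path_kernel_def \<Xi>_def)
      ultimately show "(\<integral>y. F (e (\<lambda>j\<in>{1..k}. X j \<omega>, y)) \<partial>K k (X k \<omega>)) =
          (\<integral>y. F ((\<Xi> \<omega>)(Suc k := y)) \<partial>path_kernel \<nu> K k (\<Xi> \<omega>))"
        using eq[OF \<omega>] by (auto intro!: Bochner_Integration.integral_cong)
    qed
    also have "\<dots> = \<mu>.expectation (\<lambda>x. \<integral>y. F (x(Suc k := y)) \<partial>path_kernel \<nu> K k x)"
      unfolding \<mu>_def
    proof (rule integral_distr[OF \<Xi>, symmetric], rule integral_measurable_subprob_algebra2)
      have "(\<lambda>p. (fst p)(Suc k := snd p)) \<in> ?P \<Otimes>\<^sub>M E \<rightarrow>\<^sub>M ?P"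
        by (rule measurable_fun_upd[where J = "{1..N}"]) (use k in auto)
      then show "(\<lambda>(x, y). F (x(Suc k := y))) \<in> borel_measurable (?P \<Otimes>\<^sub>M E)"
        using measurable_compose[OF _ Fm] by (auto simp: split_beta')
      have "(\<lambda>x. K k (x k)) \<in> ?P \<rightarrow>\<^sub>M subprob_algebra E"
        by (intro measurable_at_coordinate measurable_prob_algebraD K) (use k False in auto)
      then show "path_kernel \<nu> K k \<in> ?P \<rightarrow>\<^sub>M subprob_algebra E"
        using False by (simp add: path_kernel_def[abs_def])
    qed
    finally show ?thesis by simp
  qed
  have "path_chain \<mu> E N n (path_kernel \<nu> K) \<rho>"
  proof unfold_locales
    show "sets \<mu> = sets ?P" by (rule sets_\<mu>)
    show "path_kernel \<nu> K k \<in> \<mu> \<rightarrow>\<^sub>M prob_algebra E" if "k < N" for k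
    proof (cases "k = 0")
      case True
      have "\<nu> \<in> space (prob_algebra E)"
        unfolding space_prob_algebra using \<nu>.prob_space_axioms by (simp add: \<nu>_def)
      then show ?thesis using True by (simp add: path_kernel_def[abs_def])
    next
      case False
      have "(\<lambda>x. K k (x k)) \<in> ?P \<rightarrow>\<^sub>M prob_algebra E"
        by (intro measurable_at_coordinate K) (use that False in auto)
      then show ?thesis
        using False by (simp add: path_kernel_def[abs_def] measurable_cong_sets[OF sets_\<mu> refl])
    qed
    show "path_kernel \<nu> K k x = path_kernel \<nu> K k y" if "x k = y k" for k x y
      using that by (simp add: path_kernel_def)
    show "\<bar>measure (path_kernel \<nu> K k x) A - measure (path_kernel \<nu> K k y) A\<bar> \<le> \<rho>"
      if "k < N" "k < n" "x \<in> space \<mu>" "y \<in> space \<mu>" "A \<in> sets E" for k x y A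
    \<comment> \<open>At k = 0 both measures are the initial law, so their difference is 0.\<close>
    proof (cases "k = 0")
      case False
      then have "x k \<in> space E" "y k \<in> space E"
        using that unfolding space_\<mu> by (auto simp: PiE_iff)
      then show ?thesis using False that contraction by (simp add: path_kernel_def)
    qed (simp add: path_kernel_def \<rho>)
  qed (use \<rho> step in auto)
  then show ?thesis unfolding \<mu>_def \<Xi>_def \<nu>_def .
qed

lemma contraction_of_min_ergodic_coeff:
  assumes K: "K k \<in> E \<rightarrow>\<^sub>M prob_algebra E" and c: "c \<le> min_ergodic_coeff E n K"
    and k: "1 \<le> k" "k < n" and y: "y \<in> space E" and z: "z \<in> space E" and A: "A \<in> sets E"
  shows "\<bar>measure (K k y) A - measure (K k z) A\<bar> \<le> 1 - c"
proof -
  have "c \<le> ergodic_coeff E (K k)"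
  proof (rule order_trans[OF c])
    show "min_ergodic_coeff E n K \<le> ergodic_coeff E (K k)"
      using k by (auto simp: min_ergodic_coeff_def intro!: Min_le)
  qed
  moreover have "\<bar>measure (K k y) A - measure (K k z) A\<bar> \<le> dobrushin_coeff E (K k)"
  proof -
    have Kx: "prob_space (K k x)" if "x \<in> space E" for x
      using measurable_space[OF K that] by (simp add: space_prob_algebra)
    \<comment> \<open>A real supremum dominates its family only once boundedness is known;
      differences of probabilities are at most 1.\<close>
    have "bdd_above ((\<lambda>(x\<^sub>1, x\<^sub>2, B). \<bar>measure (K k x\<^sub>1) B - measure (K k x\<^sub>2) B\<bar>) ` (space E \<times> space E \<times> sets E))"
    proof (rule bdd_aboveI2[where M = 1], clarify)
      fix a b B assume "a \<in> space E" "b \<in> space E"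
      then show "\<bar>measure (K k a) B - measure (K k b) B\<bar> \<le> 1"
        using prob_space.prob_le_1[OF Kx, of a B] prob_space.prob_le_1[OF Kx, of b B]
          measure_nonneg[of "K k a" B] measure_nonneg[of "K k b" B] unfolding abs_le_iff by linarith
    qed
    from cSUP_upper[OF _ this, of "(y, z, A)"] show ?thesis
      using y z A by (simp add: dobrushin_coeff_def)
  qed
  ultimately show ?thesis by (simp add: ergodic_coeff_def)
qed

section \<open>Transfer of the bound to a single row\<close>

lemma sup_norm_bound:
  fixes f :: "nat \<Rightarrow> 'b \<Rightarrow> real"
  assumes "(MAX i\<in>{1..n}. sup_norm P (f i)) \<le> ereal b" "i \<in> {1..n}" "x \<in> space P"
  shows "\<bar>f i x\<bar> \<le> b"
proof -
  have "ereal \<bar>f i x\<bar> \<le> sup_norm P (f i)"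
    unfolding sup_norm_def by (rule SUP_upper[OF assms(3)])
  also have "\<dots> \<le> (MAX i\<in>{1..n}. sup_norm P (f i))"
    using assms(2) by (intro Max_ge) auto
  also note assms(1)
  finally show ?thesis by simp
qed

text \<open>The row sum is a fixed function S of the path, so its mean, variance and characteristic
  function may be computed under the path law, where \<open>block_chain.char_bound\<close>
  applies.\<close>

lemma markov_row_char_bound:
  fixes f :: "nat \<Rightarrow> (nat \<Rightarrow> 'a) \<Rightarrow> real"
  assumes chain: "markov_chain M E (n + m) K X"
    and n: "1 \<le> n"
    and f: "\<And>i. i \<in> {1..n} \<Longrightarrow> f i \<in> borel_measurable (block_space m E)"
      "\<And>i x. i \<in> {1..n} \<Longrightarrow> x \<in> space (block_space m E) \<Longrightarrow> \<bar>f i x\<bar> \<le> C"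
    and \<rho>: "0 \<le> \<rho>" "\<rho> < 1"
    and contraction: "\<And>k y z A. 1 \<le> k \<Longrightarrow> k < n \<Longrightarrow> y \<in> space E \<Longrightarrow> z \<in> space E \<Longrightarrow> A \<in> sets E \<Longrightarrow>
      \<bar>measure (K k y) A - measure (K k z) A\<bar> \<le> \<rho>"
  defines "e \<equiv> prob_space.expectation M (row_sum m n f X)"
    and "v \<equiv> prob_space.variance M (row_sum m n f X)"
  assumes v: "v > 0"
  shows "cmod (char (distr M borel (\<lambda>\<omega>. (row_sum m n f X \<omega> - e) / sqrt v)) t - complex_of_real (exp (- (t\<^sup>2 / 2))))
      \<le> clt_error \<rho> m C t (sqrt v)"
    and "row_sum m n f X \<in> borel_measurable M"
proof -
  let ?N = "n + m"
  let ?P = "\<Pi>\<^sub>M j\<in>{1..?N}. E"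
  define \<Xi> where "\<Xi> \<omega> = (\<lambda>j\<in>{1..?N}. X j \<omega>)" for \<omega>
  define \<mu> where "\<mu> = distr M ?P \<Xi>"
  define Z where "Z i x = f i (\<lambda>j\<in>{0..m}. x (i + j))" for i and x :: "nat \<Rightarrow> 'a"
  have X: "\<And>i. i \<in> {1..?N} \<Longrightarrow> X i \<in> M \<rightarrow>\<^sub>M E"
    using chain unfolding markov_chain_def by auto
  have \<Xi>: "\<Xi> \<in> M \<rightarrow>\<^sub>M ?P"
    unfolding \<Xi>_def by (rule measurable_path) (rule X)
  interpret path_chain \<mu> E ?N n "path_kernel (distr M E (X 1)) K" \<rho>
    unfolding \<mu>_def \<Xi>_def
    by (rule markov_chain_path_chain[OF chain _ \<rho>]) (use n contraction in auto)
  have Z: "bounded_measurable \<mu> C (Z i)" if i: "i \<in> {1..n}" for i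
    unfolding bounded_measurable_def
  proof (intro conjI ballI)
    have "(\<lambda>x. \<lambda>j\<in>{0..m}. x (i + j)) \<in> ?P \<rightarrow>\<^sub>M block_space m E"
      by (intro measurable_restrict measurable_component_singleton) (use i in auto)
    from measurable_compose[OF this f(1)[OF i]] show "Z i \<in> borel_measurable \<mu>"
      unfolding Z_def measurable_cong_sets[OF sets_\<mu> refl] .
    fix x assume "x \<in> space \<mu>"
    then have "(\<lambda>j\<in>{0..m}. x (i + j)) \<in> space (block_space m E)"
      using i unfolding space_\<mu> by (auto simp: space_PiM PiE_iff)
    then show "\<bar>Z i x\<bar> \<le> C"
      unfolding Z_def by (rule f(2)[OF i])
  qed
  interpret block_chain \<mu> E ?N n "path_kernel (distr M E (X 1)) K" \<rho> m Z C
  proof unfold_locales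
    show "depends_on \<mu> {i..i + m} (Z i)" for i
      unfolding Z_def depends_on_def by (auto intro!: arg_cong[where f = "f i"])
    obtain x where "x \<in> space \<mu>" using not_empty by auto
    then show "0 \<le> C"
      using bounded_measurable_bound[OF Z[of 1]] n by (auto intro: order_trans[OF abs_ge_zero])
  qed (use Z in auto)
  have row: "row_sum m n f X \<omega> = S (\<Xi> \<omega>)" for \<omega>
    unfolding row_sum_def S_def Z_def block_def \<Xi>_def
    by (intro sum.cong refl arg_cong2[where f = f]) auto
  have Sm: "S \<in> borel_measurable ?P"
    using bounded_measurable_measurable[OF S_bounded] by (simp add: measurable_cong_sets[OF sets_\<mu> refl])
  show row_m: "row_sum m n f X \<in> borel_measurable M"
    using measurable_compose[OF \<Xi> Sm] by (simp add: row[abs_def])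
  have e: "e = expectation S"
    unfolding e_def row[abs_def] \<mu>_def by (rule integral_distr[OF \<Xi> Sm, symmetric])
  have v_eq: "v = variance S"
  proof -
    have "v = (\<integral>\<omega>. (S (\<Xi> \<omega>) - e)\<^sup>2 \<partial>M)"
      unfolding v_def e_def row ..
    also have "\<dots> = (\<integral>x. (S x - e)\<^sup>2 \<partial>\<mu>)"
      unfolding \<mu>_def by (rule integral_distr[OF \<Xi>, symmetric]) (use Sm in measurable)
    finally show ?thesis unfolding e .
  qed
  have "char (distr M borel (\<lambda>\<omega>. (row_sum m n f X \<omega> - e) / sqrt v)) t =
      (CLINT \<omega>|M. iexp (t * ((row_sum m n f X \<omega> - e) / sqrt v)))"
    unfolding char_def by (rule integral_distr) (use row_m in measurable)
  also have "\<dots> = expectation (\<lambda>x. iexp (t * ((S x - e) / sqrt v)))"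
    unfolding row \<mu>_def by (rule integral_distr[OF \<Xi>, symmetric]) (use Sm in measurable)
  finally show "cmod (char (distr M borel (\<lambda>\<omega>. (row_sum m n f X \<omega> - e) / sqrt v)) t - complex_of_real (exp (- (t\<^sup>2 / 2))))
      \<le> clt_error \<rho> m C t (sqrt v)"
    using char_bound[of t] v by (simp only: e v_eq)
qed

section \<open>Passage to the limit along the rows\<close>

theorem corollary2:
  fixes m :: nat
    and S :: "'a::polish_space set"
    and M :: "nat \<Rightarrow> 'w measure"
    and X :: "nat \<Rightarrow> nat \<Rightarrow> 'w \<Rightarrow> 'a"
    and K :: "nat \<Rightarrow> nat \<Rightarrow> 'a \<Rightarrow> 'a measure"
    and f :: "nat \<Rightarrow> nat \<Rightarrow> (nat \<Rightarrow> 'a) \<Rightarrow> real"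
    and Cn :: "nat \<Rightarrow> real"
    and c C :: real
  assumes "S \<in> sets borel"
    and "\<And>n. n \<ge> 1 \<Longrightarrow> markov_chain (M n) (borel_on S) (n + m) (K n) (X n)"
    and "\<And>n i. 1 \<le> i \<Longrightarrow> i \<le> n \<Longrightarrow> f n i \<in> borel_measurable (block_space m (borel_on S))"
    and "\<And>n. n \<ge> 1 \<Longrightarrow>
           (MAX i\<in>{1..n}. sup_norm (block_space m (borel_on S)) (f n i)) \<le> ereal (Cn n)"
    and "c > 0"
    and "\<And>n. n \<ge> 1 \<Longrightarrow> min_ergodic_coeff (borel_on S) n (K n) \<ge> c"
    and "\<And>n. n \<ge> 1 \<Longrightarrow> Cn n \<le> C"
    and "filterlim (\<lambda>n. prob_space.variance (M n) (row_sum m n (f n) (X n))) at_top sequentially"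
  shows "weak_conv_m
           (\<lambda>n. distr (M n) borel (\<lambda>\<omega>.
              (row_sum m n (f n) (X n) \<omega> - prob_space.expectation (M n) (row_sum m n (f n) (X n)))
                / sqrt (prob_space.variance (M n) (row_sum m n (f n) (X n)))))
           std_normal_distribution"
proof -
  define v where "v n = prob_space.variance (M n) (row_sum m n (f n) (X n))" for n
  define e where "e n = prob_space.expectation (M n) (row_sum m n (f n) (X n))" for n
  define \<Phi> where "\<Phi> n = distr (M n) borel (\<lambda>\<omega>. (row_sum m n (f n) (X n) \<omega> - e n) / sqrt (v n))" for n
  \<comment> \<open>The convention that the first row has coefficient 1 gives c <= 1, so \<rho> = 1
    - c lies in [0, 1).\<close>
  have c: "c \<le> 1"
    using assms(6)[of 1] by (simp add: min_ergodic_coeff_def)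
  have K: "K n k \<in> borel_on S \<rightarrow>\<^sub>M prob_algebra (borel_on S)" if "1 \<le> n" "1 \<le> k" "k < n" for n k
    using assms(2)[OF that(1)] that unfolding markov_chain_def by auto
  have v_lim: "filterlim v at_top sequentially"
    using assms(8) unfolding v_def .
  then obtain n0 where n0: "\<And>n. n0 \<le> n \<Longrightarrow> 1 \<le> v n"
    unfolding filterlim_at_top eventually_sequentially by metis
  \<comment> \<open>From this index on the row is a genuine chain with variance at least 1, so the
    normalisation divides by a positive number.\<close>
  define n1 where "n1 = max 1 n0"
  have row: "cmod (char (\<Phi> n) t - complex_of_real (exp (- (t\<^sup>2 / 2)))) \<le> clt_error (1 - c) m C t (sqrt (v n))"
    and row_m: "row_sum m n (f n) (X n) \<in> borel_measurable (M n)"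
    if n: "n1 \<le> n" for n t
  proof -
    have n': "1 \<le> n" "v n > 0" using n n0[of n] by (auto simp: n1_def)
    have f: "\<bar>f n i x\<bar> \<le> C" if "i \<in> {1..n}" "x \<in> space (block_space m (borel_on S))" for i x
      using sup_norm_bound[OF assms(4)[OF n'(1)] that] assms(7)[OF n'(1)] by simp
    have contraction: "\<bar>measure (K n k y) A - measure (K n k z) A\<bar> \<le> 1 - c"
      if "1 \<le> k" "k < n" "y \<in> space (borel_on S)" "z \<in> space (borel_on S)" "A \<in> sets (borel_on S)" for k y z A
      by (rule contraction_of_min_ergodic_coeff[OF K[OF n'(1) that(1,2)] assms(6)[OF n'(1)] that])
    note b = markov_row_char_bound[OF assms(2)[OF n'(1)] n'(1) assms(3) f _ _ contraction n'(2)[unfolded v_def]]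
    show "cmod (char (\<Phi> n) t - complex_of_real (exp (- (t\<^sup>2 / 2)))) \<le> clt_error (1 - c) m C t (sqrt (v n))"
      unfolding \<Phi>_def e_def v_def by (rule b(1)) (use c \<open>c > 0\<close> in auto)
    show "row_sum m n (f n) (X n) \<in> borel_measurable (M n)"
      by (rule b(2)) (use c \<open>c > 0\<close> in auto)
  qed
  \<comment> \<open>Levy's theorem asks every member of the sequence to be a real distribution,
    which is known only from n1 on. Weak convergence is unaffected by the shift.\<close>
  have "weak_conv_m (\<lambda>n. \<Phi> (n + n1)) std_normal_distribution"
  proof (rule levy_continuity)
    show "real_distribution (\<Phi> (n + n1))" for n
    proof -
      have "prob_space (M (n + n1))"
        using assms(2)[of "n + n1"] by (simp add: markov_chain_def n1_def)
      then show ?thesis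
        unfolding \<Phi>_def using row_m[of "n + n1"]
        by (intro prob_space.real_distribution_distr) auto
    qed
    show "real_distribution std_normal_distribution" by (rule real_dist_normal_dist)
    fix t
    have "filterlim (\<lambda>n. sqrt (v n)) at_top sequentially"
      using filterlim_compose[OF sqrt_at_top v_lim] .
    then have "(\<lambda>n. clt_error (1 - c) m C t (sqrt (v (n + n1)))) \<longlonglongrightarrow> 0"
      by (intro LIMSEQ_ignore_initial_segment clt_error_tendsto_0)
    then have "(\<lambda>n. char (\<Phi> (n + n1)) t - complex_of_real (exp (- (t\<^sup>2 / 2)))) \<longlonglongrightarrow> 0"
      by (rule Lim_null_comparison[rotated]) (simp add: row)
    then show "(\<lambda>n. char (\<Phi> (n + n1)) t) \<longlonglongrightarrow> char std_normal_distribution t"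
      by (simp add: char_std_normal_distribution LIM_zero_iff)
  qed
  then have "weak_conv_m \<Phi> std_normal_distribution"
    unfolding weak_conv_m_def weak_conv_def by (auto dest: LIMSEQ_offset)
  then show ?thesis
    unfolding \<Phi>_def e_def v_def .
qed

end
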